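(* Let $X$ be a compact metric space on which a countable (discrete) group $T$ acts continuously on the right, $(x,t)\mapsto xt$. For real-valued $f\in C(X)$ and $t\in T$ put $f_t(x)=f(xt)$. Then the following statements are equivalent. (1) $(X,T)$ is tame. (2) For every $f\in C(X)$ and every Borel probability measure $\mu$ on $X$ (not necessarily invariant), the family $\{f_t : t\in T\}$ is $\mu$-Glivenko-Cantelli. (3) For every $f\in C(X)$ and every Borel probability measure $\mu$ on $X$ (not necessarily invariant), the family $\{f_t: t\in T\}$ has no witness of irregularity with respect to $\mu$.
   Context: Tame: the enveloping semigroup $E(X,T)$ is the closure of the set of maps $\{x\mapsto xt: t\in T\}$ in $X^X$ with the topology of pointwise convergence. $(X,T)$ is tame if each $p\in E(X,T)$ is of Baire class 1, i.e. for every $f\in C(X)$ the function $f\circ p$ is a pointwise limit of a sequence of continuous functions on $X$. Glivenko-Cantelli: a family $Z$ of $\mu$-integrable functions on $X$ is $\mu$-Glivenko-Cantelli if, for an i.i.d. sequence $\omega_1,\omega_2,\dots$ of $X$-valued random variables with common distribution $\mu$, almost surely $\lim_{N\to\infty}\sup_{f\in Z}\left|\frac1N\sum_{k=1}^N f(\omega_k)-\int f\,d\mu\right|=0$. Witness of irregularity: let $Z$ be a countable family of real-valued measurable functions on $X$ and $\alpha<\beta$ real. A finite set $F\subset X$ is $(\alpha,\beta)$-shattered by $Z$ if for every $G\subset F$ there is $f\in Z$ with $f(x)<\alpha$ for $x\in G$ and $f(x)>\beta$ for $x\in F\setminus G$. $S_n^{(\alpha,\beta)}\subset X^n$ is the set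 of $(x_1,\dots,x_n)$ with $n$ distinct entries such that $\{x_1,\dots,x_n\}$ is $(\alpha,\beta)$-shattered by $Z$. A measurable set $A\subset X$ is an $(\alpha,\beta)$-witness of irregularity if the restriction of $\mu$ to $A$ is non-atomic and for each $n\in\mathbb N$, $\mu^n$-almost every $(x_1,\dots,x_n)\in A^n$ belongs to $S_n^{(\alpha,\beta)}$. $Z$ has no witness of irregularity with respect to $\mu$ if every measurable $A$ which is an $(\alpha,\beta)$-witness of irregularity for some $\alpha<\beta$ satisfies $\mu(A)=0$. Here measurability is with respect to the $\mu$-completion of the Borel $\sigma$-algebra. *)

theory Defs
  imports "HOL-Probability.Probability" "HOL-Algebra.Group"
begin

text \<open>
  The group \<open>T\<close> carries the discrete topology, and the action map is required to be jointly
  continuous on \<open>X \<times> T\<close>; the space \<open>X\<close> is the type of points.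
\<close>

definition continuous_right_action ::
    "('t, 'b) monoid_scheme \<Rightarrow> ('a::topological_space \<Rightarrow> 't \<Rightarrow> 'a) \<Rightarrow> bool" where
  "continuous_right_action T act \<longleftrightarrow>
     group T \<and>
     (\<forall>x. act x \<one>\<^bsub>T\<^esub> = x) \<and>
     (\<forall>x. \<forall>s\<in>carrier T. \<forall>t\<in>carrier T. act x (s \<otimes>\<^bsub>T\<^esub> t) = act (act x s) t) \<and>
     continuous_map (prod_topology euclidean (discrete_topology (carrier T))) euclidean
       (\<lambda>(x, t). act x t)"

text \<open>
  The type \<open>'a \<Rightarrow> 'a\<close> has the product topology, that is, the topology of pointwise convergence.
\<close>

definition enveloping_semigroup ::
    "('t, 'b) monoid_scheme \<Rightarrow> ('a::topological_space \<Rightarrow> 't \<Rightarrow> 'a) \<Rightarrow> ('a \<Rightarrow> 'a) set" where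
  "enveloping_semigroup T act = closure ((\<lambda>t x. act x t) ` carrier T)"

definition baire_class_1 :: "('a::topological_space \<Rightarrow> 'a) \<Rightarrow> bool" where
  "baire_class_1 p \<longleftrightarrow>
     (\<forall>f::'a \<Rightarrow> real. continuous_on UNIV f \<longrightarrow>
        (\<exists>g::nat \<Rightarrow> 'a \<Rightarrow> real. (\<forall>n. continuous_on UNIV (g n)) \<and>
           (\<forall>x. (\<lambda>n. g n x) \<longlonglongrightarrow> f (p x))))"

definition tame ::
    "('t, 'b) monoid_scheme \<Rightarrow> ('a::topological_space \<Rightarrow> 't \<Rightarrow> 'a) \<Rightarrow> bool" where
  "tame T act \<longleftrightarrow> (\<forall>p\<in>enveloping_semigroup T act. baire_class_1 p)"

definition translates ::
    "('t, 'b) monoid_scheme \<Rightarrow> ('a \<Rightarrow> 't \<Rightarrow> 'a) \<Rightarrow> ('a \<Rightarrow> real) \<Rightarrow> ('a \<Rightarrow> real) set" where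
  "translates T act f = (\<lambda>t x. f (act x t)) ` carrier T"

text \<open>
  The i.i.d. sequence is the coordinate process on the infinite product of copies of \<open>M\<close>, indexed
  from \<open>0\<close>. The supremum is taken in \<^typ>\<open>ennreal\<close>, so that it is meaningful (possibly \<open>\<infinity>\<close>) for
  families that are not uniformly bounded.
\<close>

definition glivenko_cantelli :: "'a measure \<Rightarrow> ('a \<Rightarrow> real) set \<Rightarrow> bool" where
  "glivenko_cantelli M Z \<longleftrightarrow>
     (\<forall>f\<in>Z. integrable M f) \<and>
     (AE \<omega> in (\<Pi>\<^sub>M k\<in>(UNIV::nat set). M).
        (\<lambda>N. SUP f\<in>Z. ennreal \<bar>(\<Sum>k<N. f (\<omega> k)) / real N - integral\<^sup>L M f\<bar>) \<longlonglongrightarrow> 0)"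

definition shattered :: "('a \<Rightarrow> real) set \<Rightarrow> real \<Rightarrow> real \<Rightarrow> 'a set \<Rightarrow> bool" where
  "shattered Z \<alpha> \<beta> F \<longleftrightarrow>
     finite F \<and> (\<forall>G\<subseteq>F. \<exists>f\<in>Z. (\<forall>x\<in>G. f x < \<alpha>) \<and> (\<forall>x\<in>F - G. f x > \<beta>))"

text \<open>Points of \<open>X\<^sup>n\<close> are the extensional functions on \<open>{..<n}\<close>, as in \<open>\<Pi>\<^sub>M\<close>.\<close>

definition shattered_tuples ::
    "('a \<Rightarrow> real) set \<Rightarrow> real \<Rightarrow> real \<Rightarrow> nat \<Rightarrow> (nat \<Rightarrow> 'a) set" where
  "shattered_tuples Z \<alpha> \<beta> n =
     {x \<in> {..<n} \<rightarrow>\<^sub>E UNIV. inj_on x {..<n} \<and> shattered Z \<alpha> \<beta> (x ` {..<n})}"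

text \<open>This says that there are no atoms when \<open>M\<close> is finite, the only case used here.\<close>

definition nonatomic :: "'a measure \<Rightarrow> bool" where
  "nonatomic M \<longleftrightarrow>
     (\<forall>B\<in>sets M. 0 < emeasure M B \<longrightarrow>
        (\<exists>C\<in>sets M. C \<subseteq> B \<and> 0 < emeasure M C \<and> emeasure M C < emeasure M B))"

text \<open>
  Measurability of \<open>A\<close> refers to the completion of \<open>M\<close>. The product measure need not be completed,
  since \<open>AE\<close> accepts any exceptional set that is contained in a null set.
\<close>

definition irregularity_witness ::
    "'a measure \<Rightarrow> ('a \<Rightarrow> real) set \<Rightarrow> real \<Rightarrow> real \<Rightarrow> 'a set \<Rightarrow> bool" where
  "irregularity_witness M Z \<alpha> \<beta> A \<longleftrightarrow>
     A \<in> sets (completion M) \<and>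
     nonatomic (restrict_space (completion M) A) \<and>
     (\<forall>n. AE x in (\<Pi>\<^sub>M i\<in>{..<n}. M).
        x \<in> ({..<n} \<rightarrow>\<^sub>E A) \<longrightarrow> x \<in> shattered_tuples Z \<alpha> \<beta> n)"

definition no_irregularity_witness :: "'a measure \<Rightarrow> ('a \<Rightarrow> real) set \<Rightarrow> bool" where
  "no_irregularity_witness M Z \<longleftrightarrow>
     (\<forall>\<alpha> \<beta> A. \<alpha> < \<beta> \<longrightarrow> irregularity_witness M Z \<alpha> \<beta> A \<longrightarrow> emeasure (completion M) A = 0)"

end

theory Submission
  imports Defs
begin

text \<open>
  Fix a continuous \<open>f\<close> and let \<open>Z\<close> be the countable, uniformly bounded family of its translates. All
  three properties turn out to fail for the same reason, an obstruction in \<open>Z\<close> that comes in two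
  guises. A \<^emph>\<open>splitting set\<close> for \<open>\<alpha> < \<beta>\<close> is a nonempty closed \<open>C\<close> such that any finitely many open
  sets meeting \<open>C\<close> are split by a single \<open>h \<in> Z\<close>, which goes below \<open>\<alpha>\<close> and above \<open>\<beta>\<close> on \<open>C\<close> inside
  each of them. Splitting again and again along a Cantor scheme gives
  \<^emph>\<open>Cantor independence\<close>: a continuous image of \<open>{0,1}\<^sup>\<nat>\<close> in \<open>X\<close> on which functions \<open>h\<^sub>0, h\<^sub>1, \<dots>\<close>
  from \<open>Z\<close> act as the coordinates (\<open>splitting_set_imp_cantor_independent\<close>).

  The obstruction destroys all three properties. If \<open>h\<^sub>n = f(\<cdot> t\<^sub>n)\<close> are Cantor independent and \<open>p\<close> is
  a cluster point of the maps \<open>t\<^sub>n\<close>, then \<open>f \<circ> p\<close> is at most \<open>\<alpha>\<close> on a dense subset of the Cantor set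
  and at least \<open>\<beta>\<close> on another one; a pointwise limit of continuous functions cannot do this, by the
  Baire category theorem (\<open>cantor_independent_imp_not_tame\<close>). Pushing the fair coin measure forward
  to \<open>X\<close> gives a measure \<open>\<mu>\<close> for which the signs of the \<open>h\<^sub>n\<close> are independent and fair. Almost surely
  every sign pattern on a finite sample is then realized by infinitely many \<open>h\<^sub>n\<close>. Hence \<open>X\<close>
  itself is a witness of irregularity. Moreover, infinitely many empirical means are below \<open>\<alpha>\<close> and
  infinitely many above \<open>\<beta>\<close>, while along a subsequence the integrals of the \<open>h\<^sub>n\<close> converge, so the
  Glivenko-Cantelli property fails.

  Conversely, each failure produces a splitting set.

  \<^item> If \<open>f \<circ> p\<close> is not of Baire class 1, there are \<open>a < b\<close> and a closed set \<open>C\<close> in which the points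
    with value below \<open>a\<close> and those with value above \<open>b\<close> are both dense
    (\<open>non_limit_of_continuous_oscillates\<close>). Approximating \<open>p\<close> by a translation at finitely many
    such points splits given open sets.

  \<^item> If \<open>A\<close> is a witness of positive measure, its essential support is a splitting set: for open
    sets meeting the support, almost every tuple with two entries from each of them is shattered.

  \<^item> If \<open>Z\<close> is not Glivenko-Cantelli, it cannot be covered by finitely many classes whose upper and
    lower envelopes are close in the mean, since otherwise the strong law for the finitely
    many envelopes would control all of \<open>Z\<close>. Among the subfamilies without such a cover choose a
    decreasing sequence whose mean envelope gap is nearly minimal. The gap stays open on a set \<open>D\<close>
    of positive measure, and the essential support of \<open>D\<close> is a splitting set: if no function of a
    late subfamily split given open sets, that subfamily would be a finite union of classes, each of
    which stays on one side on a portion of \<open>D\<close>; one of the classes is again without a cover, and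
    its mean gap is smaller by a fixed amount, against minimality
    (\<open>not_bracketable_imp_splitting_set\<close>).
\<close>

section \<open>Splitting sets and Cantor independence\<close>

text \<open>
  The two sides are indexed by a truth value so that a pattern of sides is a Boolean function, that
  is, a point of the Cantor space or a subset of a sample.
\<close>

definition side :: "real \<Rightarrow> real \<Rightarrow> ('a \<Rightarrow> real) \<Rightarrow> bool \<Rightarrow> 'a set" where
  "side \<alpha> \<beta> f b = {x. if b then \<beta> < f x else f x < \<alpha>}"

definition splitting_set :: "('a::topological_space \<Rightarrow> real) set \<Rightarrow> real \<Rightarrow> real \<Rightarrow> 'a set \<Rightarrow> bool" where
  "splitting_set Z \<alpha> \<beta> C \<longleftrightarrow> closed C \<and> C \<noteq> {} \<and>
     (\<forall>\<U>. finite \<U> \<longrightarrow> (\<forall>U\<in>\<U>. open U \<and> U \<inter> C \<noteq> {}) \<longrightarrow>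
        (\<exists>f\<in>Z. \<forall>U\<in>\<U>. \<forall>b. U \<inter> C \<inter> side \<alpha> \<beta> f b \<noteq> {}))"

definition cantor_independent :: "('a::topological_space \<Rightarrow> real) set \<Rightarrow> real \<Rightarrow> real \<Rightarrow> bool" where
  "cantor_independent Z \<alpha> \<beta> \<longleftrightarrow> (\<exists>(\<phi> :: (nat \<Rightarrow> bool) \<Rightarrow> 'a) f. continuous_on UNIV \<phi> \<and>
     (\<forall>n. f n \<in> Z) \<and> (\<forall>s n. \<phi> s \<in> side \<alpha> \<beta> (f n) (s n)))"

lemma open_side:
  assumes "continuous_on UNIV f"
  shows "open (side \<alpha> \<beta> f b)"
  using assms by (cases b) (auto simp: side_def intro!: open_Collect_less)

lemma open_cylinder: "open {s' :: nat \<Rightarrow> bool. \<forall>i<n. s' i = s i}"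
proof -
  have "{s'. \<forall>i<n. s' i = s i} = Pi\<^sub>E UNIV (\<lambda>i. if i < n then {s i} else UNIV)"
    by (auto simp: PiE_def Pi_def split: if_splits)
  moreover have "open (Pi\<^sub>E UNIV (\<lambda>i. if i < n then {s i} else (UNIV :: bool set)))"
    by (rule open_PiE) (auto intro: finite_subset[of _ "{..<n}"] Topological_Spaces.open_discrete)
  ultimately show ?thesis by simp
qed

lemma open_contains_cylinder:
  assumes "open W" "(s :: nat \<Rightarrow> bool) \<in> W"
  obtains n where "{s'. \<forall>i<n. s' i = s i} \<subseteq> W"
proof -
  have "openin (product_topology (\<lambda>i. euclidean) UNIV) W"
    using assms(1) by (simp add: euclidean_product_topology open_openin[symmetric])
  then obtain X where X: "s \<in> Pi\<^sub>E UNIV X" "finite {i. X i \<noteq> topspace euclidean}" "Pi\<^sub>E UNIV X \<subseteq> W"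
    using product_topology_open_contains_basis[of "\<lambda>i. euclidean" UNIV W s] assms(2) by blast
  obtain n where n: "\<And>i. X i \<noteq> UNIV \<Longrightarrow> i < n"
    using X(2) finite_nat_set_iff_bounded[of "{i. X i \<noteq> UNIV}"] by auto
  have "s' \<in> Pi\<^sub>E UNIV X" if s': "\<forall>i<n. s' i = s i" for s'
  proof -
    have "s' i \<in> X i" for i
    proof (cases "X i = UNIV")
      case False
      then have "s' i = s i"
        using n s' by simp
      moreover have "s i \<in> X i"
        using X(1) by (rule PiE_mem) simp
      ultimately show ?thesis by simp
    qed simp
    then show ?thesis by auto
  qed
  then have "{s'. \<forall>i<n. s' i = s i} \<subseteq> W"
    using X(3) by (intro subsetI) (simp add: subset_iff)
  then show thesis
    by (rule that)
qed

text \<open>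
  At stage \<open>n\<close> the scheme consists of \<open>2\<^sup>n\<close> balls centred in \<open>C\<close>, indexed by Boolean lists. As they
  are finitely many open sets meeting \<open>C\<close>, one function splits all of them; small balls
  around points of the two sides form the next stage. Using one common radius per stage keeps
  the state of the recursion simple and makes the radii tend to \<open>0\<close> uniformly, which gives
  the continuity of \<open>\<phi>\<close>.
\<close>

lemma splitting_set_imp_cantor_independent:
  fixes Z :: "('a::metric_space \<Rightarrow> real) set"
  assumes cpt: "compact (UNIV :: 'a set)" and cont: "\<And>f. f \<in> Z \<Longrightarrow> continuous_on UNIV f"
    and C: "splitting_set Z \<alpha> \<beta> C"
  shows "cantor_independent Z \<alpha> \<beta>"
proof -
  have "C \<noteq> {}" and split: "\<And>\<U>. finite \<U> \<Longrightarrow> (\<And>U. U \<in> \<U> \<Longrightarrow> open U \<and> U \<inter> C \<noteq> {}) \<Longrightarrow>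
      \<exists>f\<in>Z. \<forall>U\<in>\<U>. \<forall>b. U \<inter> C \<inter> side \<alpha> \<beta> f b \<noteq> {}"
    using C unfolding splitting_set_def by simp_all
  \<comment> \<open>A state consists of the centres and the common radius of a stage.\<close>
  define P where "P n st \<longleftrightarrow> (case st of (x, r) \<Rightarrow>
      0 < r \<and> r \<le> (1/2)^n \<and> (\<forall>l. length l = n \<longrightarrow> x l \<in> C))" for n and st :: "(bool list \<Rightarrow> 'a) \<times> real"
  define Q where "Q n st st' \<longleftrightarrow> (case (st, st') of ((x, r), (x', r')) \<Rightarrow>
      \<exists>f\<in>Z. \<forall>l b. length l = n \<longrightarrow> cball (x' (l @ [b])) r' \<subseteq> ball (x l) r \<inter> side \<alpha> \<beta> f b)"
    for n and st st' :: "(bool list \<Rightarrow> 'a) \<times> real"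
  have "\<exists>st. \<forall>n. P n (st n) \<and> Q n (st n) (st (Suc n))"
  proof (rule dependent_nat_choice)
    obtain c where "c \<in> C"
      using \<open>C \<noteq> {}\<close> by blast
    then show "\<exists>st. P 0 st"
      unfolding P_def by (intro exI[of _ "(\<lambda>l. c, 1)"]) simp
  next
    fix st n assume "P n st"
    then obtain x r where st: "st = (x, r)" and r: "0 < r" "r \<le> (1/2)^n"
      and x: "\<And>l. length l = n \<Longrightarrow> x l \<in> C"
      unfolding P_def by (cases st) auto
    have fin: "finite {l :: bool list. length l = n}"
      using finite_lists_length_eq[of "UNIV :: bool set" n] by simp
    have "\<exists>f\<in>Z. \<forall>U\<in>(\<lambda>l. ball (x l) r) ` {l. length l = n}. \<forall>b. U \<inter> C \<inter> side \<alpha> \<beta> f b \<noteq> {}"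
    proof (rule split)
      show "open U \<and> U \<inter> C \<noteq> {}" if "U \<in> (\<lambda>l. ball (x l) r) ` {l. length l = n}" for U
        using that x r(1) by (force simp: disjoint_iff)
    qed (use fin in simp)
    then obtain f where f: "f \<in> Z" "\<And>l b. length l = n \<Longrightarrow> ball (x l) r \<inter> C \<inter> side \<alpha> \<beta> f b \<noteq> {}"
      by auto
    then have "\<exists>y. length l = n \<longrightarrow> y \<in> ball (x l) r \<inter> C \<inter> side \<alpha> \<beta> f b" for l b
      by blast
    then obtain y where y: "\<And>l b. length l = n \<Longrightarrow> y l b \<in> ball (x l) r \<inter> C \<inter> side \<alpha> \<beta> f b"
      by metis
    have "\<exists>\<rho>>0. length l = n \<longrightarrow> cball (y l b) \<rho> \<subseteq> ball (x l) r \<inter> side \<alpha> \<beta> f b" for l b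
    proof (cases "length l = n")
      case True
      have "open (ball (x l) r \<inter> side \<alpha> \<beta> f b)"
        using open_side[OF cont[OF f(1)]] by blast
      then show ?thesis
        using y[OF True, of b] unfolding open_contains_cball by blast
    qed (auto intro: exI[of _ 1])
    then obtain \<rho> where \<rho>: "\<And>l b. \<rho> l b > 0"
      "\<And>l b. length l = n \<Longrightarrow> cball (y l b) (\<rho> l b) \<subseteq> ball (x l) r \<inter> side \<alpha> \<beta> f b"
      by metis
    define R where "R = insert ((1/2)^Suc n) ((\<lambda>(l, b). \<rho> l b) ` ({l. length l = n} \<times> UNIV))"
    have R: "finite R" "R \<noteq> {}"
      unfolding R_def using fin by simp_all
    have "(0::real) < (1/2)^Suc n"
      by simp
    then have R_pos: "\<rho> > 0" if "\<rho> \<in> R" for \<rho>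
      using that \<rho>(1) unfolding R_def by (auto simp del: power_Suc)
    define r' where "r' = Min R"
    have "\<rho> l b \<in> R" if "length l = n" for l b
      using that image_eqI[of "\<rho> l b" "\<lambda>(l, b). \<rho> l b" "(l, b)"] unfolding R_def by simp
    moreover have "(1/2)^Suc n \<in> R"
      unfolding R_def by (rule insertI1)
    ultimately have r': "0 < r'" "r' \<le> (1/2)^Suc n" "\<And>l b. length l = n \<Longrightarrow> r' \<le> \<rho> l b"
      unfolding r'_def using R_pos[OF Min_in[OF R]] Min_le[OF R(1)] by blast+
    let ?x' = "\<lambda>l. y (butlast l) (last l)"
    have "P (Suc n) (?x', r')"
      unfolding P_def using r' y by auto
    moreover have "Q n st (?x', r')"
      unfolding Q_def st prod.case
    proof (intro bexI[OF _ f(1)] allI impI)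
      fix l :: "bool list" and b assume l: "length l = n"
      have "cball (y l b) r' \<subseteq> cball (y l b) (\<rho> l b)"
        using r'(3)[OF l] by (rule subset_cball)
      then show "cball (y (butlast (l @ [b])) (last (l @ [b]))) r' \<subseteq> ball (x l) r \<inter> side \<alpha> \<beta> f b"
        using \<rho>(2)[OF l, of b] unfolding butlast_snoc last_snoc by (rule order_trans)
    qed
    ultimately show "\<exists>st'. P (Suc n) st' \<and> Q n st st'" by blast
  qed
  then obtain st where st: "\<And>n. P n (st n)" "\<And>n. Q n (st n) (st (Suc n))" by blast
  define x where "x n = fst (st n)" for n
  define r where "r n = snd (st n)" for n
  have r: "0 < r n" "r n \<le> (1/2)^n" for n
    using st(1)[of n] unfolding P_def r_def by (auto simp: case_prod_beta)
  obtain f where f: "\<And>n. f n \<in> Z" "\<And>n l b. length l = n \<Longrightarrow>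
      cball (x (Suc n) (l @ [b])) (r (Suc n)) \<subseteq> ball (x n l) (r n) \<inter> side \<alpha> \<beta> (f n) b"
    using st(2) unfolding Q_def x_def r_def case_prod_beta fst_conv snd_conv by metis
  define K where "K s n = cball (x n (map s [0..<n])) (r n)" for s n
  have K_Suc: "K s (Suc n) \<subseteq> ball (x n (map s [0..<n])) (r n) \<inter> side \<alpha> \<beta> (f n) (s n)" for s n
    using f(2)[of "map s [0..<n]" n "s n"] unfolding K_def by simp
  have "compact_space (euclidean :: 'a topology)"
    using cpt by (simp add: compact_space_def)
  then have "(\<Inter>n. K s n) \<noteq> {}" for s
  proof (rule compact_space_imp_nest)
    show "closedin euclidean (K s n)" for n
      unfolding K_def by simp
    show "K s n \<noteq> {}" for n
      unfolding K_def using r(1)[of n] by (simp add: not_less[symmetric])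
    have "K s (Suc n) \<subseteq> K s n" for n
      using K_Suc[of s n] ball_subset_cball unfolding K_def by blast
    then show "decseq (K s)"
      by (rule decseq_SucI)
  qed
  then have "\<exists>y. \<forall>n. y \<in> K s n" for s
    by blast
  then obtain \<phi> where \<phi>: "\<And>s n. \<phi> s \<in> K s n"
    by metis
  have "continuous_on UNIV \<phi>"
    unfolding continuous_on_topological
  proof (intro ballI allI impI)
    fix s W assume "open W" "\<phi> s \<in> W"
    then obtain e where e: "e > 0" "ball (\<phi> s) e \<subseteq> W"
      by (meson open_contains_ball)
    obtain n where n: "(1/2::real)^n < e / 2"
      using real_arch_pow_inv[of "e/2" "1/2"] e(1) by auto
    let ?A = "{s'. \<forall>i<n. s' i = s i}"
    have "\<phi> s' \<in> W" if "s' \<in> ?A" for s'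
    proof -
      have "map s' [0..<n] = map s [0..<n]"
        using that by auto
      then have "\<phi> s' \<in> cball (x n (map s [0..<n])) (r n)" "\<phi> s \<in> cball (x n (map s [0..<n])) (r n)"
        using \<phi>[of s' n] \<phi>[of s n] unfolding K_def by (simp_all only:)
      then have "dist (\<phi> s) (\<phi> s') \<le> r n + r n"
        by (metis add_mono dist_commute dist_triangle3 mem_cball order_trans)
      then have "dist (\<phi> s) (\<phi> s') < e"
        using r(2)[of n] n by simp
      then show ?thesis
        using e(2) by auto
    qed
    then show "\<exists>A. open A \<and> s \<in> A \<and> (\<forall>y\<in>UNIV. y \<in> A \<longrightarrow> \<phi> y \<in> W)"
      using open_cylinder[of n s] by blast
  qed
  moreover have "\<phi> s \<in> side \<alpha> \<beta> (f n) (s n)" for s n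
    using \<phi>[of s "Suc n"] K_Suc[of s n] by blast
  ultimately show ?thesis
    unfolding cantor_independent_def using f(1) by blast
qed

section \<open>Cantor independence contradicts tameness\<close>

lemma Baire_cantor_space:
  fixes G :: "nat \<Rightarrow> (nat \<Rightarrow> bool) set"
  assumes "\<And>n. open (G n)" "\<And>n. closure (G n) = UNIV"
  shows "(\<Inter>n. G n) \<noteq> {}"
proof -
  have top: "(euclidean :: (nat \<Rightarrow> bool) topology) = product_topology (\<lambda>_. euclidean) UNIV"
    by (rule euclidean_product_topology[symmetric])
  have "compact_space (euclidean :: bool topology)"
    by (simp add: compact_space_def finite_imp_compact compactin_euclidean_iff)
  then have "compact_space (euclidean :: (nat \<Rightarrow> bool) topology)"
    unfolding top by (simp add: compact_space_product_topology)
  moreover have "Hausdorff_space (euclidean :: (nat \<Rightarrow> bool) topology)"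
    unfolding top Hausdorff_space_product_topology
    using hausdorff[where 'a = bool] by (auto simp: Hausdorff_space_def disjnt_def)
  ultimately have "locally_compact_space (euclidean :: (nat \<Rightarrow> bool) topology)"
    "regular_space (euclidean :: (nat \<Rightarrow> bool) topology)"
    by (auto simp: compact_imp_locally_compact_space compact_Hausdorff_imp_regular_space)
  then have "euclidean closure_of \<Inter>(range G) = topspace euclidean"
    using assms by (intro Baire_category) auto
  then show ?thesis
    by fastforce
qed

lemma cluster_point_of_sequence:
  fixes g :: "nat \<Rightarrow> 'a::topological_space"
  assumes "compact (UNIV :: 'a set)"
  obtains p where "p \<in> closure (range g)" "\<And>W. open W \<Longrightarrow> p \<in> W \<Longrightarrow> frequently (\<lambda>n. g n \<in> W) sequentially"
proof -
  have "filtermap g sequentially \<noteq> bot"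
    by (simp add: filtermap_bot_iff)
  then obtain p where p: "inf (nhds p) (filtermap g sequentially) \<noteq> bot"
    using assms unfolding compact_filter by (metis UNIV_I always_eventually)
  have fr: "frequently (\<lambda>n. g n \<in> W) sequentially" if "open W" "p \<in> W" for W
  proof -
    have "\<not> eventually (\<lambda>n. g n \<notin> W) sequentially"
    proof
      assume "eventually (\<lambda>n. g n \<notin> W) sequentially"
      then have "eventually (\<lambda>y. y \<notin> W) (filtermap g sequentially)"
        by (simp add: eventually_filtermap)
      moreover have "eventually (\<lambda>y. y \<in> W) (nhds p)"
        using that by (rule eventually_nhds_in_open)
      ultimately have "eventually (\<lambda>y. False) (inf (nhds p) (filtermap g sequentially))"
        unfolding eventually_inf by (metis (mono_tags, lifting))
      then show False
        using p by (simp add: trivial_limit_def)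
    qed
    then show ?thesis
      by (simp add: frequently_def)
  qed
  moreover have "p \<in> closure (range g)"
    unfolding closure_iff_nhds_not_empty
    using fr by (metis (no_types, lifting) disjoint_iff frequently_ex rangeI subsetD)
  ultimately show thesis
    using that by blast
qed

text \<open>
  Let \<open>p\<close> be a cluster point of the translations. Where the coordinate sequence is eventually false,
  \<open>f \<circ> p\<close> is at most \<open>\<alpha>\<close>, where it is eventually true, at least \<open>\<beta>\<close>; both kinds of sequences
  are dense in the Cantor space. If continuous \<open>g\<^sub>n\<close> converged to \<open>f \<circ> p\<close>, then for \<open>\<alpha> < \<gamma> < \<delta> < \<beta>\<close>
  the conditions that \<open>g\<^sub>n < \<gamma>\<close> infinitely often and that \<open>g\<^sub>n > \<delta>\<close> infinitely often would define
  dense \<open>G\<^sub>\<delta>\<close> sets, and a common point would contradict convergence.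
\<close>

lemma cantor_independent_imp_not_tame:
  fixes act :: "'a::metric_space \<Rightarrow> 't \<Rightarrow> 'a"
  assumes cpt: "compact (UNIV :: 'a set)" and f: "continuous_on UNIV f" and "\<alpha> < \<beta>"
    and ind: "cantor_independent (translates T act f) \<alpha> \<beta>"
  shows "\<not> tame T act"
proof
  assume tame: "tame T act"
  obtain \<phi> :: "(nat \<Rightarrow> bool) \<Rightarrow> 'a" and F where \<phi>: "continuous_on UNIV \<phi>"
    and F: "\<And>n. F n \<in> translates T act f" and side: "\<And>s n. \<phi> s \<in> side \<alpha> \<beta> (F n) (s n)"
    using ind unfolding cantor_independent_def by auto
  have "\<exists>t. t \<in> carrier T \<and> F n = (\<lambda>x. f (act x t))" for n
    using F[of n] unfolding translates_def by blast
  then obtain t where t: "\<And>n. t n \<in> carrier T" "\<And>n. F n = (\<lambda>x. f (act x (t n)))"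
    by metis
  have "compact_space (euclidean :: 'a topology)"
    using cpt by (simp add: compact_space_def compactin_euclidean_iff)
  then have "compact_space (euclidean :: ('a \<Rightarrow> 'a) topology)"
    unfolding euclidean_product_topology[symmetric] by (simp add: compact_space_product_topology)
  then have cpt': "compact (UNIV :: ('a \<Rightarrow> 'a) set)"
    by (simp add: compact_space_def compactin_euclidean_iff)
  obtain p where p: "p \<in> closure (range (\<lambda>n x. act x (t n)))"
    "\<And>W. open W \<Longrightarrow> p \<in> W \<Longrightarrow> frequently (\<lambda>n. (\<lambda>x. act x (t n)) \<in> W) sequentially"
    using cluster_point_of_sequence[OF cpt', of "\<lambda>n x. act x (t n)"] by blast
  have "p \<in> enveloping_semigroup T act"
    unfolding enveloping_semigroup_def
    using p(1) t(1) closure_mono[of "range (\<lambda>n x. act x (t n))" "(\<lambda>t x. act x t) ` carrier T"] by blast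
  then obtain g where g: "\<And>n. continuous_on UNIV (g n)" "\<And>x. (\<lambda>n. g n x) \<longlonglongrightarrow> f (p x)"
    using tame f unfolding tame_def baire_class_1_def by meson
  have coord: "open {q :: 'a \<Rightarrow> 'a. q x \<in> V}" if "open V" for x V
    using open_vimage[OF that continuous_on_product_coordinates[of x]] by (simp add: vimage_def)
  have fr: "frequently (\<lambda>n. F n x \<in> V) sequentially" if "open V" "f (p x) \<in> V" for x V
  proof -
    have "open (f -` V)"
      using that(1) f by (rule open_vimage)
    from p(2)[OF coord[OF this, of x]] show ?thesis
      using that(2) by (simp add: t(2))
  qed
  have low: "f (p (\<phi> s)) \<le> \<alpha>" if "eventually (\<lambda>n. \<not> s n) sequentially" for s
  proof (rule ccontr)
    assume "\<not> ?thesis"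
    then have "frequently (\<lambda>n. F n (\<phi> s) \<in> {\<alpha><..}) sequentially"
      by (intro fr) auto
    from frequently_eventually_conj[OF this that]
    have "frequently (\<lambda>n. \<not> s n \<and> F n (\<phi> s) \<in> {\<alpha><..}) sequentially" .
    then obtain n where "\<not> s n" "\<alpha> < F n (\<phi> s)"
      by (auto dest: frequently_ex)
    then show False
      using side[of s n] by (simp add: side_def)
  qed
  have high: "\<beta> \<le> f (p (\<phi> s))" if "eventually (\<lambda>n. s n) sequentially" for s
  proof (rule ccontr)
    assume "\<not> ?thesis"
    then have "frequently (\<lambda>n. F n (\<phi> s) \<in> {..<\<beta>}) sequentially"
      by (intro fr) auto
    from frequently_eventually_conj[OF this that]
    have "frequently (\<lambda>n. s n \<and> F n (\<phi> s) \<in> {..<\<beta>}) sequentially" .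
    then obtain n where "s n" "F n (\<phi> s) < \<beta>"
      by (auto dest: frequently_ex)
    then show False
      using side[of s n] by (simp add: side_def)
  qed
  obtain \<gamma> \<delta> where ord: "\<alpha> < \<gamma>" "\<gamma> < \<delta>" "\<delta> < \<beta>"
    using \<open>\<alpha> < \<beta>\<close> dense by meson
  define L where "L n = (\<Union>m\<in>{n..}. \<phi> -` side \<gamma> \<delta> (g m) False)" for n
  define U where "U n = (\<Union>m\<in>{n..}. \<phi> -` side \<gamma> \<delta> (g m) True)" for n
  have "open (\<phi> -` side \<gamma> \<delta> (g m) b)" for m b
    using open_side[OF g(1)] \<phi> by (rule open_vimage)
  then have opn: "open (L n)" "open (U n)" for n
    unfolding L_def U_def by auto
  have dense: "closure G = UNIV" if "\<And>s. eventually (\<lambda>n. s n = b) sequentially \<Longrightarrow> s \<in> G" for G and b :: bool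
  proof -
    have "s \<in> closure G" for s
      unfolding closure_iff_nhds_not_empty
    proof (intro allI impI)
      fix A V assume A: "V \<subseteq> A" "s \<in> V" "open V"
      obtain n where n: "{s'. \<forall>i<n. s' i = s i} \<subseteq> V"
        using open_contains_cylinder[OF A(3,2)] by blast
      have "eventually (\<lambda>i. (if i < n then s i else b) = b) sequentially"
        using eventually_ge_at_top[of n] by eventually_elim simp
      then have "(\<lambda>i. if i < n then s i else b) \<in> G"
        by (rule that)
      moreover have "(\<lambda>i. if i < n then s i else b) \<in> V"
        using n by auto
      ultimately show "G \<inter> A \<noteq> {}"
        using A(1) by blast
    qed
    then show ?thesis by blast
  qed
  have dL: "closure (L n) = UNIV" for n
  proof (rule dense[of False])
    fix s assume "eventually (\<lambda>n. s n = False) sequentially"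
    then have "f (p (\<phi> s)) < \<gamma>"
      using low[of s] ord by simp
    then have "eventually (\<lambda>m. g m (\<phi> s) < \<gamma>) sequentially"
      using g(2) by (rule order_tendstoD(2)[rotated])
    then obtain m where "m \<ge> n" "g m (\<phi> s) < \<gamma>"
      unfolding eventually_sequentially by (metis nle_le)
    then show "s \<in> L n"
      unfolding L_def side_def by auto
  qed
  have dU: "closure (U n) = UNIV" for n
  proof (rule dense[of True])
    fix s assume "eventually (\<lambda>n. s n = True) sequentially"
    then have "\<delta> < f (p (\<phi> s))"
      using high[of s] ord by simp
    then have "eventually (\<lambda>m. \<delta> < g m (\<phi> s)) sequentially"
      using g(2) by (rule order_tendstoD(1)[rotated])
    then obtain m where "m \<ge> n" "\<delta> < g m (\<phi> s)"
      unfolding eventually_sequentially by (metis nle_le)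
    then show "s \<in> U n"
      unfolding U_def side_def by auto
  qed
  \<comment> \<open>Both countable families are interleaved into one sequence of dense open sets.\<close>
  have "(\<Inter>n. if even n then L n else U n) \<noteq> {}"
    by (rule Baire_cantor_space) (auto simp: opn dL dU)
  then obtain s where s: "\<And>n. s \<in> (if even n then L n else U n)"
    by blast
  have "\<exists>m\<ge>n. g m (\<phi> s) < \<gamma>" for n
  proof -
    have "s \<in> L (2 * n)"
      using s[of "2 * n"] by simp
    then obtain m where "m \<ge> 2 * n" "g m (\<phi> s) < \<gamma>"
      unfolding L_def side_def by auto
    then show ?thesis
      by (intro exI[of _ m]) simp
  qed
  moreover have "\<exists>m\<ge>n. \<delta> < g m (\<phi> s)" for n
  proof -
    have "s \<in> U (Suc (2 * n))"
      using s[of "Suc (2 * n)"] by simp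
    then obtain m where "m \<ge> Suc (2 * n)" "\<delta> < g m (\<phi> s)"
      unfolding U_def side_def by auto
    then show ?thesis
      by (intro exI[of _ m]) simp
  qed
  ultimately have "frequently (\<lambda>m. g m (\<phi> s) < \<gamma>) sequentially" "frequently (\<lambda>m. \<delta> < g m (\<phi> s)) sequentially"
    by (simp_all add: frequently_sequentially)
  moreover have "\<gamma> < f (p (\<phi> s)) \<or> f (p (\<phi> s)) < \<delta>"
    using ord(2) by linarith
  then have "eventually (\<lambda>m. \<not> g m (\<phi> s) < \<gamma>) sequentially \<or> eventually (\<lambda>m. \<not> \<delta> < g m (\<phi> s)) sequentially"
  proof
    assume "\<gamma> < f (p (\<phi> s))"
    then have "eventually (\<lambda>m. \<gamma> < g m (\<phi> s)) sequentially"
      by (rule order_tendstoD(1)[OF g(2)])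
    then have "eventually (\<lambda>m. \<not> g m (\<phi> s) < \<gamma>) sequentially"
      by eventually_elim simp
    then show ?thesis ..
  next
    assume "f (p (\<phi> s)) < \<delta>"
    then have "eventually (\<lambda>m. g m (\<phi> s) < \<delta>) sequentially"
      by (rule order_tendstoD(2)[OF g(2)])
    then have "eventually (\<lambda>m. \<not> \<delta> < g m (\<phi> s)) sequentially"
      by eventually_elim simp
    then show ?thesis ..
  qed
  ultimately show False
    unfolding frequently_def by blast
qed

section \<open>Fair signs on a Cantor set\<close>

text \<open>
  The finite-dimensional distributions say that the events \<open>f\<^sub>m > \<beta>\<close> behave like independent fair
  coin tosses, and that up to a null set the alternative is \<open>f\<^sub>m < \<alpha>\<close>.
\<close>

locale fair_signs = prob_space M for M :: "'a measure" +
  fixes f :: "nat \<Rightarrow> 'a \<Rightarrow> real" and \<alpha> \<beta> :: real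
  assumes space_UNIV: "space M = UNIV" and less: "\<alpha> < \<beta>"
    and side_sets: "\<And>m b. side \<alpha> \<beta> (f m) b \<in> sets M"
    and prob_pattern: "\<And>J t. finite J \<Longrightarrow> prob (\<Inter>m\<in>J. side \<alpha> \<beta> (f m) (t m)) = (1/2) ^ card J"
begin

lemma prob_side_constraints:
  fixes t :: "'i \<Rightarrow> bool"
  assumes K: "K \<subseteq> I" "finite K" and J: "finite J"
  shows "measure (PiM I (\<lambda>_. M)) {x\<in>space (PiM I (\<lambda>_. M)). \<forall>i\<in>K. \<forall>m\<in>J. x i \<in> side \<alpha> \<beta> (f m) (t i)}
    = (1/2) ^ (card K * card J)"
proof -
  interpret P: product_prob_space "\<lambda>_. M" I
    by (intro product_prob_spaceI) (rule prob_space_axioms)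
  have A: "(\<Inter>m\<in>J. side \<alpha> \<beta> (f m) (t i)) \<in> sets M" for i
  proof (cases "J = {}")
    case True then show ?thesis using sets.top[of M] space_UNIV by simp
  next
    case False then show ?thesis using side_sets J by (intro sets.finite_INT) auto
  qed
  have "{x\<in>space (PiM I (\<lambda>_. M)). \<forall>i\<in>K. \<forall>m\<in>J. x i \<in> side \<alpha> \<beta> (f m) (t i)}
      = {x\<in>space (PiM I (\<lambda>_. M)). \<forall>i\<in>K. x i \<in> (\<Inter>m\<in>J. side \<alpha> \<beta> (f m) (t i))}"
    by auto
  then have "emeasure (PiM I (\<lambda>_. M)) {x\<in>space (PiM I (\<lambda>_. M)). \<forall>i\<in>K. \<forall>m\<in>J. x i \<in> side \<alpha> \<beta> (f m) (t i)}
      = (\<Prod>i\<in>K. emeasure M (\<Inter>m\<in>J. side \<alpha> \<beta> (f m) (t i)))"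
    using P.emeasure_PiM_Collect[OF K, of "\<lambda>i. \<Inter>m\<in>J. side \<alpha> \<beta> (f m) (t i)"] A by simp
  also have "\<dots> = (\<Prod>i\<in>K. ennreal ((1/2) ^ card J))"
    using prob_pattern[OF J] by (simp add: emeasure_eq_measure)
  also have "\<dots> = ennreal ((1/2) ^ (card K * card J))"
    by (simp add: ennreal_power flip: power_mult mult.commute[of "card K"])
  finally show ?thesis
    by (simp add: measure_def)
qed

text \<open>
  For a fixed pattern \<open>t\<close> on a finite set of sample points, the events that \<open>f\<^sub>m\<close> realizes it are
  independent in \<open>m\<close> and all have the same positive probability, so the zero-one law makes
  infinitely many of them happen.
\<close>

lemma AE_infinitely_often_side:
  fixes t :: "'i \<Rightarrow> bool"
  assumes K: "K \<subseteq> I" "finite K"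
  shows "AE x in PiM I (\<lambda>_. M). infinite {m. \<forall>i\<in>K. x i \<in> side \<alpha> \<beta> (f m) (t i)}"
proof -
  let ?P = "PiM I (\<lambda>_. M)"
  interpret P: prob_space ?P
    by (rule prob_space_PiM) (rule prob_space_axioms)
  define F where "F m = {x\<in>space ?P. \<forall>i\<in>K. x i \<in> side \<alpha> \<beta> (f m) (t i)}" for m
  have F: "F m \<in> sets ?P" for m
    unfolding F_def using side_sets K by (intro sets.sets_Collect_finite_All sets_Collect_single') (auto simp: space_UNIV)
  have INT_F: "(\<Inter>m\<in>J. F m) = {x\<in>space ?P. \<forall>i\<in>K. \<forall>m\<in>J. x i \<in> side \<alpha> \<beta> (f m) (t i)}" if "J \<noteq> {}" for J
    using that unfolding F_def by blast
  have PJ: "P.prob (\<Inter>m\<in>J. F m) = (1/2) ^ (card K * card J)" if "J \<noteq> {}" "finite J" for J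
    unfolding INT_F[OF that(1)] by (rule prob_side_constraints[OF K that(2)])
  have PF: "P.prob (F m) = (1/2) ^ card K" for m
    using PJ[of "{m}"] by simp
  have ind: "P.indep_events F UNIV"
    unfolding P.indep_events_def using F PJ by (auto simp: PF power_mult)
  have "P.prob (\<Inter>n. \<Union>m\<in>{n..}. F m) \<noteq> 0"
  proof -
    have "decseq (\<lambda>n. \<Union>m\<in>{n..}. F m)"
      unfolding decseq_def by (intro allI impI UN_mono) auto
    then have "(\<lambda>n. P.prob (\<Union>m\<in>{n..}. F m)) \<longlonglongrightarrow> P.prob (\<Inter>n. \<Union>m\<in>{n..}. F m)"
      using F by (intro P.finite_Lim_measure_decseq) auto
    moreover have "(1/2) ^ card K \<le> P.prob (\<Union>m\<in>{n..}. F m)" for n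
      unfolding PF[of n, symmetric] using F by (intro P.finite_measure_mono sets.countable_UN) auto
    ultimately have "(1/2) ^ card K \<le> P.prob (\<Inter>n. \<Union>m\<in>{n..}. F m)"
      by (intro LIMSEQ_le_const) auto
    moreover have "(0::real) < (1/2) ^ card K"
      by simp
    ultimately show ?thesis by linarith
  qed
  then have "P.prob (\<Inter>n. \<Union>m\<in>{n..}. F m) = 1"
    using P.borel_0_1_law[OF ind] by blast
  then have "AE x in ?P. x \<in> (\<Inter>n. \<Union>m\<in>{n..}. F m)"
    using F by (intro P.AE_prob_1)
  then show ?thesis
  proof eventually_elim
    case (elim x)
    then show ?case
      unfolding infinite_nat_iff_unbounded_le F_def by auto
  qed
qed

text \<open>
  Almost every tuple is shattered because each of the finitely many patterns is realized, and it
  has distinct entries because any two of them are told apart by some \<open>f\<^sub>m\<close>. An atom would, for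
  every \<open>m\<close>, lie almost entirely on one side of \<open>f\<^sub>m\<close>, and therefore, for every \<open>L\<close>, almost
  entirely in a set of measure \<open>2\<^sup>-\<^sup>L\<close>.
\<close>

lemma whole_space_irregularity_witness:
  assumes f: "\<And>n. f n \<in> Z"
  shows "irregularity_witness M Z \<alpha> \<beta> UNIV"
  unfolding irregularity_witness_def
proof (intro conjI allI)
  let ?C = "completion M"
  interpret C: prob_space ?C
    by (rule prob_space_completion)
  have spC: "space ?C = UNIV"
    using space_UNIV by simp
  show U: "UNIV \<in> sets ?C"
    using sets.top[of ?C] by (simp only: spC)
  have rC: "sets (restrict_space ?C UNIV) = sets ?C"
    using spC by (simp add: sets_restrict_space)
  have emC: "emeasure (restrict_space ?C UNIV) B = emeasure ?C B" for B
    using U by (subst emeasure_restrict_space) auto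
  show "nonatomic (restrict_space ?C UNIV)"
    unfolding nonatomic_def rC emC
  proof (intro ballI impI, rule ccontr)
    fix B assume B: "B \<in> sets ?C" "0 < emeasure ?C B"
      and no: "\<not> (\<exists>C\<in>sets ?C. C \<subseteq> B \<and> 0 < emeasure ?C C \<and> emeasure ?C C < emeasure ?C B)"
    have sC: "side \<alpha> \<beta> (f m) b \<in> sets ?C" for m b
      using side_sets by (rule sets_completionI_sets)
    have dich: "C.prob (B \<inter> D) = 0 \<or> C.prob (B \<inter> D) = C.prob B" if "D \<in> sets ?C" for D
    proof -
      have "B \<inter> D \<in> sets ?C" "B \<inter> D \<subseteq> B"
        using that B by auto
      then have "\<not> (0 < C.prob (B \<inter> D) \<and> C.prob (B \<inter> D) < C.prob B)"
        using no by (auto simp: C.emeasure_eq_measure ennreal_less_iff)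
      moreover have "C.prob (B \<inter> D) \<le> C.prob B"
        using B by (intro C.finite_measure_mono) auto
      ultimately show ?thesis
        using measure_nonneg[of ?C "B \<inter> D"] by linarith
    qed
    \<comment> \<open>\<open>t m\<close> is the side of \<open>f m\<close> on which almost all of the atom \<open>B\<close> lies.\<close>
    define t where "t m \<longleftrightarrow> C.prob (B \<inter> side \<alpha> \<beta> (f m) False) = 0" for m
    have cov: "C.prob (side \<alpha> \<beta> (f m) False \<union> side \<alpha> \<beta> (f m) True) = 1" for m
    proof -
      have half: "C.prob (side \<alpha> \<beta> (f m) b) = 1/2" for b
        using prob_pattern[of "{m}" "\<lambda>_. b"] side_sets by (simp add: measure_completion)
      have "side \<alpha> \<beta> (f m) False \<inter> side \<alpha> \<beta> (f m) True = {}"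
        using less by (auto simp: side_def)
      then have "C.prob (side \<alpha> \<beta> (f m) False \<union> side \<alpha> \<beta> (f m) True)
          = C.prob (side \<alpha> \<beta> (f m) False) + C.prob (side \<alpha> \<beta> (f m) True)"
        by (rule C.finite_measure_Union[OF sC sC])
      then show ?thesis
        unfolding half by simp
    qed
    have full: "C.prob (B \<inter> side \<alpha> \<beta> (f m) (t m)) = C.prob B" for m
    proof (cases "t m")
      case True
      have "C.prob B = C.prob (B \<inter> (side \<alpha> \<beta> (f m) False \<union> side \<alpha> \<beta> (f m) True))"
        using cov[of m] B(1) sC by (intro C.measure_space_inter[symmetric]) (auto simp: prob_space)
      also have "\<dots> \<le> C.prob (B \<inter> side \<alpha> \<beta> (f m) False) + C.prob (B \<inter> side \<alpha> \<beta> (f m) True)"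
        unfolding Int_Un_distrib using B sC by (intro measure_Un_le) auto
      finally have "C.prob B \<le> C.prob (B \<inter> side \<alpha> \<beta> (f m) True)"
        using True unfolding t_def by simp
      moreover have "C.prob (B \<inter> side \<alpha> \<beta> (f m) True) \<le> C.prob B"
        using B by (intro C.finite_measure_mono) auto
      ultimately show ?thesis
        using True by simp
    next
      case False
      then show ?thesis
        using dich[OF sC, of m False] unfolding t_def by simp
    qed
    have AE_m: "AE x in ?C. x \<in> B \<longrightarrow> x \<in> side \<alpha> \<beta> (f m) (t m)" for m
    proof -
      have "C.prob (B - side \<alpha> \<beta> (f m) (t m)) = 0"
        using full[of m] B sC C.finite_measure_Diff'[of B "side \<alpha> \<beta> (f m) (t m)"] by simp
      then have "B - side \<alpha> \<beta> (f m) (t m) \<in> null_sets ?C"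
        using B sC by (auto simp: null_sets_def C.emeasure_eq_measure)
      then have "AE x in ?C. x \<notin> B - side \<alpha> \<beta> (f m) (t m)"
        by (rule AE_not_in)
      then show ?thesis by eventually_elim blast
    qed
    have "C.prob B \<le> (1/2) ^ L" for L
    proof -
      have "AE x in ?C. x \<in> B \<longrightarrow> x \<in> (\<Inter>m\<in>{..<L}. side \<alpha> \<beta> (f m) (t m))"
      proof -
        have "AE x in ?C. \<forall>m. x \<in> B \<longrightarrow> x \<in> side \<alpha> \<beta> (f m) (t m)"
          unfolding AE_all_countable using AE_m by blast
        then show ?thesis by eventually_elim simp
      qed
      moreover have IM: "(\<Inter>m\<in>{..<L}. side \<alpha> \<beta> (f m) (t m)) \<in> sets M"
        using side_sets sets.top[of M] space_UNIV by (cases "L = 0") (auto intro!: sets.finite_INT)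
      ultimately have "C.prob B \<le> C.prob (\<Inter>m\<in>{..<L}. side \<alpha> \<beta> (f m) (t m))"
        using sets_completionI_sets[OF IM] by (intro C.finite_measure_mono_AE)
      also have "\<dots> = (1/2) ^ L"
        using prob_pattern[of "{..<L}" t] IM by (simp add: measure_completion)
      finally show ?thesis .
    qed
    then have "C.prob B \<le> 0"
      using LIMSEQ_realpow_zero[of "1/2"] by (intro LIMSEQ_le_const[of "\<lambda>L. (1/2)^L"]) auto
    then show False
      using B(2) by (simp add: C.emeasure_eq_measure)
  qed
  fix n :: nat
  have "AE x in PiM {..<n} (\<lambda>_. M). \<forall>G\<in>Pow {..<n}. infinite {m. \<forall>i\<in>{..<n}. x i \<in> side \<alpha> \<beta> (f m) (i \<notin> G)}"
    by (intro AE_finite_allI AE_infinitely_often_side) auto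
  then show "AE x in PiM {..<n} (\<lambda>_. M). x \<in> ({..<n} \<rightarrow>\<^sub>E UNIV) \<longrightarrow> x \<in> shattered_tuples Z \<alpha> \<beta> n"
  proof eventually_elim
    case (elim x)
    have ex: "\<exists>m. \<forall>i<n. x i \<in> side \<alpha> \<beta> (f m) (i \<notin> G)" if "G \<subseteq> {..<n}" for G
    proof -
      have "infinite {m. \<forall>i\<in>{..<n}. x i \<in> side \<alpha> \<beta> (f m) (i \<notin> G)}"
        using elim that by blast
      then show ?thesis
        using infinite_imp_nonempty by fastforce
    qed
    have disj: "b = b'" if "y \<in> side \<alpha> \<beta> h b" "y \<in> side \<alpha> \<beta> h b'" for y h b b'
      using that less by (cases b; cases b') (auto simp: side_def)
    have inj: "inj_on x {..<n}"
    proof (rule inj_onI)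
      fix i j assume ij: "i \<in> {..<n}" "j \<in> {..<n}" "x i = x j"
      obtain m where m: "\<forall>k<n. x k \<in> side \<alpha> \<beta> (f m) (k \<notin> {i})"
        using ex[of "{i}"] ij by blast
      have "x i \<in> side \<alpha> \<beta> (f m) (i \<notin> {i})" "x j \<in> side \<alpha> \<beta> (f m) (j \<notin> {i})"
        using m ij by auto
      then have "(i \<notin> {i}) = (j \<notin> {i})"
        unfolding ij(3) by (rule disj)
      then show "i = j"
        by simp
    qed
    have "shattered Z \<alpha> \<beta> (x ` {..<n})"
      unfolding shattered_def
    proof (intro conjI allI impI)
      fix G assume G: "G \<subseteq> x ` {..<n}"
      obtain m where m: "\<forall>i<n. x i \<in> side \<alpha> \<beta> (f m) (i \<notin> {i. i < n \<and> x i \<in> G})"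
        using ex[of "{i. i < n \<and> x i \<in> G}"] by auto
      show "\<exists>f\<in>Z. (\<forall>x\<in>G. f x < \<alpha>) \<and> (\<forall>x\<in>x ` {..<n} - G. \<beta> < f x)"
        using m G f by (intro bexI[of _ "f m"]) (auto simp: side_def subset_iff)
    qed simp
    then show ?case
      using inj by (auto simp: shattered_tuples_def)
  qed
qed

text \<open>
  The integrals of the \<open>f\<^sub>n\<close> are not known individually, but along a subsequence they converge to
  some \<open>c\<close>. Along this subsequence there are still infinitely many functions that are
  below \<open>\<alpha>\<close> on the whole sample, and infinitely many that are above \<open>\<beta>\<close>, so uniform closeness of
  empirical means and integrals would force both \<open>c \<le> \<alpha> + \<delta>\<close> and \<open>c \<ge> \<beta> - \<delta>\<close>.
\<close>

lemma not_glivenko_cantelli: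
  assumes f: "\<And>n. f n \<in> Z" and bd: "\<And>h x. h \<in> Z \<Longrightarrow> \<bar>h x\<bar> \<le> B"
  shows "\<not> glivenko_cantelli M Z"
proof
  assume gc: "glivenko_cantelli M Z"
  let ?P = "PiM (UNIV :: nat set) (\<lambda>_. M)"
  interpret P: prob_space ?P
    by (rule prob_space_PiM) (rule prob_space_axioms)
  have int: "integrable M (f n)" for n
    using gc f unfolding glivenko_cantelli_def by blast
  have "\<bar>integral\<^sup>L M (f n)\<bar> \<le> B" for n
  proof -
    have "\<bar>integral\<^sup>L M (f n)\<bar> \<le> (\<integral>x. \<bar>f n x\<bar> \<partial>M)"
      by (rule integral_abs_bound)
    also have "\<dots> \<le> (\<integral>x. B \<partial>M)"
      using int bd[OF f] by (intro integral_mono) auto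
    finally show ?thesis by (simp add: prob_space)
  qed
  then have "bounded (range (\<lambda>n. integral\<^sup>L M (f n)))"
    unfolding bounded_iff by auto
  then obtain c r where r: "strict_mono (r :: nat \<Rightarrow> nat)" and c: "(\<lambda>n. integral\<^sup>L M (f (r n))) \<longlonglongrightarrow> c"
    using bounded_imp_convergent_subsequence[of "\<lambda>n. integral\<^sup>L M (f n)"] by (auto simp: o_def)
  have pattern_r: "measure M (\<Inter>m\<in>J. side \<alpha> \<beta> (f (r m)) (t m)) = (1/2) ^ card J" if "finite J" for J t
  proof -
    have inj: "inj r"
      using r by (rule strict_mono_imp_inj_on)
    have "(\<Inter>m\<in>J. side \<alpha> \<beta> (f (r m)) (t m)) = (\<Inter>m\<in>r ` J. side \<alpha> \<beta> (f m) (t (inv_into UNIV r m)))"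
      using inj by simp
    then show ?thesis
      using prob_pattern[of "r ` J" "\<lambda>m. t (inv_into UNIV r m)"] that inj by (simp add: card_image inj_on_subset)
  qed
  interpret R: fair_signs M "\<lambda>n. f (r n)" \<alpha> \<beta>
    by unfold_locales (use space_UNIV less side_sets pattern_r in auto)
  have io: "AE \<omega> in ?P. \<forall>b N. infinite {m. \<forall>i\<in>{..<N}. \<omega> i \<in> side \<alpha> \<beta> (f (r m)) b}"
    unfolding AE_all_countable
    by (intro allI R.AE_infinitely_often_side[where t = "\<lambda>_. _"]) auto
  have conv: "AE \<omega> in ?P. (\<lambda>N. SUP h\<in>Z. ennreal \<bar>(\<Sum>k<N. h (\<omega> k)) / real N - integral\<^sup>L M h\<bar>) \<longlonglongrightarrow> 0"
    using gc unfolding glivenko_cantelli_def by blast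
  have "AE \<omega> in ?P. False"
    using io conv
  proof eventually_elim
    case (elim \<omega>)
    define \<delta> where "\<delta> = (\<beta> - \<alpha>) / 3"
    have \<delta>: "\<delta> > 0"
      unfolding \<delta>_def using less by simp
    have "eventually (\<lambda>N. (SUP h\<in>Z. ennreal \<bar>(\<Sum>k<N. h (\<omega> k)) / real N - integral\<^sup>L M h\<bar>) < ennreal \<delta>) sequentially"
      using elim(2) \<delta> by (intro order_tendstoD(2)) auto
    then have "eventually (\<lambda>N. 0 < N \<and> (SUP h\<in>Z. ennreal \<bar>(\<Sum>k<N. h (\<omega> k)) / real N - integral\<^sup>L M h\<bar>) < ennreal \<delta>) sequentially"
      by (rule eventually_conj[OF eventually_gt_at_top])
    then obtain N where N: "N > 0"
      "(SUP h\<in>Z. ennreal \<bar>(\<Sum>k<N. h (\<omega> k)) / real N - integral\<^sup>L M h\<bar>) < ennreal \<delta>"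
      using eventually_happens'[OF sequentially_bot] by blast
    have close: "\<bar>(\<Sum>k<N. f n (\<omega> k)) / real N - integral\<^sup>L M (f n)\<bar> < \<delta>" for n
    proof -
      have "ennreal \<bar>(\<Sum>k<N. f n (\<omega> k)) / real N - integral\<^sup>L M (f n)\<bar> < ennreal \<delta>"
        using f[of n] N(2) by (intro le_less_trans[OF SUP_upper N(2)])
      then show ?thesis
        by (simp add: ennreal_less_iff)
    qed
    have "c \<le> \<alpha> + \<delta>"
    proof (rule ccontr)
      assume "\<not> ?thesis"
      then have "eventually (\<lambda>m. \<alpha> + \<delta> < integral\<^sup>L M (f (r m))) sequentially"
        using c by (intro order_tendstoD(1)) auto
      then obtain m0 where m0: "\<And>m. m \<ge> m0 \<Longrightarrow> \<alpha> + \<delta> < integral\<^sup>L M (f (r m))"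
        unfolding eventually_sequentially by blast
      have "infinite {m. \<forall>i\<in>{..<N}. \<omega> i \<in> side \<alpha> \<beta> (f (r m)) False}"
        using elim(1) by blast
      then obtain m where m: "m \<ge> m0" "\<And>i. i < N \<Longrightarrow> \<omega> i \<in> side \<alpha> \<beta> (f (r m)) False"
        unfolding infinite_nat_iff_unbounded_le by blast
      have "(\<Sum>k<N. f (r m) (\<omega> k)) \<le> (\<Sum>k<N. \<alpha>)"
        using m(2) by (intro sum_mono) (auto simp: side_def less_imp_le)
      then have "(\<Sum>k<N. f (r m) (\<omega> k)) / real N \<le> \<alpha>"
        using N(1) by (simp add: field_simps)
      then show False
        using close[of "r m"] m0[OF m(1)] by linarith
    qed
    moreover have "\<beta> - \<delta> \<le> c"
    proof (rule ccontr)
      assume "\<not> ?thesis"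
      then have "eventually (\<lambda>m. integral\<^sup>L M (f (r m)) < \<beta> - \<delta>) sequentially"
        using c by (intro order_tendstoD(2)) auto
      then obtain m0 where m0: "\<And>m. m \<ge> m0 \<Longrightarrow> integral\<^sup>L M (f (r m)) < \<beta> - \<delta>"
        unfolding eventually_sequentially by blast
      have "infinite {m. \<forall>i\<in>{..<N}. \<omega> i \<in> side \<alpha> \<beta> (f (r m)) True}"
        using elim(1) by blast
      then obtain m where m: "m \<ge> m0" "\<And>i. i < N \<Longrightarrow> \<omega> i \<in> side \<alpha> \<beta> (f (r m)) True"
        unfolding infinite_nat_iff_unbounded_le by blast
      have "(\<Sum>k<N. \<beta>) \<le> (\<Sum>k<N. f (r m) (\<omega> k))"
        using m(2) by (intro sum_mono) (auto simp: side_def less_imp_le)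
      then have "\<beta> \<le> (\<Sum>k<N. f (r m) (\<omega> k)) / real N"
        using N(1) by (simp add: field_simps)
      then show False
        using close[of "r m"] m0[OF m(1)] by linarith
    qed
    ultimately show False
      using \<delta> unfolding \<delta>_def by (simp add: field_simps)
  qed
  then show False
    by simp
qed

end

text \<open>
  The measure is the law of \<open>\<phi>\<close> under fair coin tossing. Open subsets of the Cantor space are
  countable unions of cylinders, so \<open>\<phi>\<close> is measurable for the product \<open>\<sigma>\<close>-algebra.
\<close>

lemma cantor_independent_imp_fair_signs:
  fixes Z :: "('a::metric_space \<Rightarrow> real) set"
  assumes cont: "\<And>f. f \<in> Z \<Longrightarrow> continuous_on UNIV f" and "\<alpha> < \<beta>" and ind: "cantor_independent Z \<alpha> \<beta>"
  obtains M :: "'a measure" and f :: "nat \<Rightarrow> 'a \<Rightarrow> real" where "fair_signs M f \<alpha> \<beta>" "sets M = sets borel" "\<And>n. f n \<in> Z"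
proof -
  obtain \<phi> :: "(nat \<Rightarrow> bool) \<Rightarrow> 'a" and f where \<phi>: "continuous_on UNIV \<phi>"
    and f: "\<And>n. f n \<in> Z" and side: "\<And>s n. \<phi> s \<in> side \<alpha> \<beta> (f n) (s n)"
    using ind unfolding cantor_independent_def by auto
  let ?coin = "measure_pmf (bernoulli_pmf (1/2))"
  let ?Q = "PiM (UNIV :: nat set) (\<lambda>_. ?coin)"
  interpret P: product_prob_space "\<lambda>_::nat. ?coin" UNIV
    by (intro product_prob_spaceI) (rule measure_pmf.prob_space_axioms)
  have spQ: "space ?Q = UNIV"
    by (simp add: space_PiM)
  have cyl: "{s'. \<forall>i\<in>J. s' i = s i} \<in> sets ?Q" if "finite J" for J s
  proof -
    have "{x \<in> space ?Q. \<forall>i\<in>J. x i = s i} \<in> sets ?Q"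
      using that by (intro sets.sets_Collect_finite_All sets_Collect_single') auto
    then show ?thesis by (simp add: spQ)
  qed
  have opn: "W \<in> sets ?Q" if "open W" for W
  proof -
    define cl where "cl l = {s' :: nat \<Rightarrow> bool. \<forall>i\<in>{..<length l}. s' i = l ! i}" for l
    have "W = (\<Union>l\<in>{l. cl l \<subseteq> W}. cl l)"
    proof (intro subset_antisym subsetI)
      fix s assume "s \<in> W"
      then obtain n where n: "{s'. \<forall>i<n. s' i = s i} \<subseteq> W"
        using open_contains_cylinder[OF \<open>open W\<close>] by blast
      have "cl (map s [0..<n]) = {s'. \<forall>i<n. s' i = s i}"
        unfolding cl_def by auto
      then show "s \<in> (\<Union>l\<in>{l. cl l \<subseteq> W}. cl l)"
        using n by (intro UN_I[of "map s [0..<n]"]) auto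
    qed auto
    moreover have "cl l \<in> sets ?Q" for l
      unfolding cl_def using cyl[of "{..<length l}" "\<lambda>i. l ! i"] by simp
    then have "(\<Union>l\<in>{l. cl l \<subseteq> W}. cl l) \<in> sets ?Q"
      by (intro sets.countable_UN') auto
    ultimately show ?thesis by simp
  qed
  have meas: "\<phi> \<in> measurable ?Q borel"
  proof (rule borel_measurableI)
    fix S :: "'a set" assume "open S"
    then have "open (\<phi> -` S)"
      using \<phi> by (rule open_vimage)
    then show "\<phi> -` S \<inter> space ?Q \<in> sets ?Q"
      using opn by (simp add: spQ)
  qed
  define M where "M = distr ?Q borel \<phi>"
  have side_borel: "side \<alpha> \<beta> (f m) b \<in> sets borel" for m b
    using open_side[OF cont[OF f]] by simp
  have pattern: "measure M (\<Inter>m\<in>J. side \<alpha> \<beta> (f m) (t m)) = (1/2) ^ card J" if J: "finite J" for J t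
  proof -
    have "(\<Inter>m\<in>J. side \<alpha> \<beta> (f m) (t m)) \<in> sets borel"
      using J side_borel by (cases "J = {}") (auto intro!: sets.finite_INT)
    then have "measure M (\<Inter>m\<in>J. side \<alpha> \<beta> (f m) (t m)) = measure ?Q (\<phi> -` (\<Inter>m\<in>J. side \<alpha> \<beta> (f m) (t m)))"
      unfolding M_def using meas by (simp add: measure_distr spQ)
    also have "\<phi> s \<in> side \<alpha> \<beta> (f m) b \<longleftrightarrow> s m = b" for s m b
      using side[of s m] \<open>\<alpha> < \<beta>\<close> by (cases "s m"; cases b) (auto simp: side_def)
    then have "\<phi> -` (\<Inter>m\<in>J. side \<alpha> \<beta> (f m) (t m)) = {s\<in>space ?Q. \<forall>m\<in>J. s m \<in> {t m}}"
      by (auto simp: spQ)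
    also have "measure ?Q \<dots> = (1/2) ^ card J"
    proof -
      have "emeasure ?Q {s\<in>space ?Q. \<forall>m\<in>J. s m \<in> {t m}} = (\<Prod>m\<in>J. emeasure ?coin {t m})"
        using J by (intro P.emeasure_PiM_Collect) auto
      also have "\<dots> = (\<Prod>m\<in>J. ennreal (1/2))"
      proof (rule prod.cong)
        show "emeasure ?coin {t m} = ennreal (1/2)" for m
          by (cases "t m") (simp_all add: emeasure_pmf_single)
      qed simp
      also have "\<dots> = ennreal ((1/2) ^ card J)"
        unfolding prod_constant by (rule ennreal_power) simp
      finally show ?thesis
        by (simp add: measure_def)
    qed
    finally show ?thesis .
  qed
  have "prob_space M"
    unfolding M_def using meas by (rule P.prob_space_distr)
  then have "fair_signs M f \<alpha> \<beta>"
    unfolding fair_signs_def fair_signs_axioms_def using \<open>\<alpha> < \<beta>\<close> side_borel pattern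
    by (auto simp: M_def)
  then show thesis
    by (rule that) (auto simp: M_def f)
qed

section \<open>Oscillation of functions that are not of Baire class 1\<close>

lemma countable_base_of_compact:
  assumes "compact (UNIV :: 'a::metric_space set)"
  obtains B :: "'a::metric_space set set" where "countable B" "\<And>b. b \<in> B \<Longrightarrow> open b"
    "\<And>U x. open U \<Longrightarrow> x \<in> U \<Longrightarrow> \<exists>b\<in>B. x \<in> b \<and> b \<subseteq> U"
proof -
  have "\<exists>k. finite k \<and> (UNIV :: 'a set) \<subseteq> (\<Union>x\<in>k. ball x (1 / real (Suc n)))" for n
    using compactE_image[OF assms, of UNIV "\<lambda>x. ball x (1 / real (Suc n))"]
    by (metis UNIV_I centre_in_ball divide_pos_pos of_nat_0_less_iff open_ball subsetI UN_I zero_less_Suc zero_less_one)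
  then obtain k where k: "\<And>n. finite (k n)" "\<And>n. (UNIV :: 'a set) \<subseteq> (\<Union>x\<in>k n. ball x (1 / real (Suc n)))"
    by metis
  define B where "B = (\<Union>n. (\<lambda>x. ball x (1 / real (Suc n))) ` k n)"
  show thesis
  proof
    show "countable B"
      unfolding B_def using k(1) by (intro countable_UN countable_image) (auto intro: countable_finite)
    show "open b" if "b \<in> B" for b
      using that unfolding B_def by auto
    fix U and x :: 'a
    assume "open U" "x \<in> U"
    then obtain e where e: "e > 0" "ball x e \<subseteq> U"
      by (meson open_contains_ball)
    obtain n where n: "1 / real (Suc n) < e / 2"
      using nat_approx_posE[of "e / 2"] e(1) by auto
    obtain y where y: "y \<in> k n" "x \<in> ball y (1 / real (Suc n))"
      using k(2)[of n] by blast
    have "ball y (1 / real (Suc n)) \<subseteq> ball x e"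
    proof
      fix z assume "z \<in> ball y (1 / real (Suc n))"
      then have "dist y z < e / 2" "dist y x < e / 2"
        using y(2) n by auto
      then show "z \<in> ball x e"
        using dist_triangle[of x z y] by (simp add: dist_commute)
    qed
    then show "\<exists>b\<in>B. x \<in> b \<and> b \<subseteq> U"
      using y e(2) unfolding B_def by blast
  qed
qed

text \<open>
  These are the \<open>\<Delta>\<^sup>0\<^sub>2\<close> sets; their indicator functions are limits of continuous functions.
\<close>

definition ambiguous :: "'a::topological_space set \<Rightarrow> bool" where
  "ambiguous H \<longleftrightarrow> fsigma_in euclidean H \<and> fsigma_in euclidean (- H)"

lemma fsigma_open_Int_closed:
  fixes U :: "'a::metric_space set"
  assumes "open U" "closed C"
  shows "fsigma_in euclidean (U \<inter> C)"
  using assms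
  by (intro fsigma_in_Int open_imp_fsigma_in metrizable_space_euclidean closed_imp_fsigma_in) auto

lemma ambiguous_glue:
  assumes "ambiguous H" "ambiguous K" "ambiguous L"
  shows "ambiguous ((H \<inter> K) \<union> (L - H))"
proof -
  have "- ((H \<inter> K) \<union> (L - H)) = (H \<inter> - K) \<union> (- H \<inter> - L)"
    by blast
  then show ?thesis
    using assms unfolding ambiguous_def Diff_eq by (auto intro!: fsigma_in_Un fsigma_in_Int)
qed

text \<open>
  The Cantor-Bendixson derivation that separates \<open>P\<close> from \<open>Q\<close> is usually indexed by countable
  ordinals. It can be replaced by a maximality argument: the union \<open>W\<close> of all basic open sets on
  which a separation exists is a countable union, so it admits a separation itself; if it were not
  the whole space, the hypothesis on its complement would enlarge it.
\<close>

lemma ambiguous_separation: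
  fixes P Q :: "'a::metric_space set"
  assumes cpt: "compact (UNIV :: 'a set)"
    and nd: "\<And>C. closed C \<Longrightarrow> C \<noteq> {} \<Longrightarrow> \<exists>U. open U \<and> U \<inter> C \<noteq> {} \<and> (U \<inter> C \<inter> P = {} \<or> U \<inter> C \<inter> Q = {})"
  obtains H where "ambiguous H" "P \<subseteq> H" "H \<inter> Q = {}"
proof -
  define sep where "sep G H \<longleftrightarrow> H \<subseteq> G \<and> fsigma_in euclidean H \<and> fsigma_in euclidean (G - H)
      \<and> P \<inter> G \<subseteq> H \<and> H \<inter> Q = {}" for G H
  obtain B :: "'a set set" where B: "countable B" "\<And>b. b \<in> B \<Longrightarrow> open b"
    "\<And>U x. open U \<Longrightarrow> x \<in> U \<Longrightarrow> \<exists>b\<in>B. x \<in> b \<and> b \<subseteq> U"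
    using countable_base_of_compact[OF cpt] by blast
  define B' where "B' = {b\<in>B. \<exists>H. sep b H}"
  define W where "W = \<Union>B'"
  have cB': "countable B'"
    using B(1) unfolding B'_def by simp
  have openW: "open W"
    using B(2) unfolding W_def B'_def by auto
  have small: "G \<subseteq> W" if "open G" "sep G H" for G H
  proof
    fix x assume "x \<in> G"
    obtain b where b: "b \<in> B" "x \<in> b" "b \<subseteq> G"
      using B(3)[OF \<open>open G\<close> \<open>x \<in> G\<close>] by blast
    have "b - H \<inter> b = b \<inter> (G - H)"
      using b by blast
    then have "sep b (H \<inter> b)"
      using that fsigma_in_Int[OF _ open_imp_fsigma_in[OF metrizable_space_euclidean, of b]] B(2)[OF b(1)] b
      unfolding sep_def by (auto simp: Int_commute[of b])
    then show "x \<in> W"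
      using b unfolding W_def B'_def by blast
  qed
  have "\<exists>H. sep W H"
  proof (cases "B' = {}")
    case True
    then show ?thesis
      by (auto simp: sep_def W_def)
  next
    case False
    define b where "b = from_nat_into B'"
    have rb: "range b = B'"
      unfolding b_def using cB' False by (simp add: range_from_nat_into)
    have "\<exists>h. sep (b n) h" for n
      using rangeI[of b n] unfolding rb B'_def by blast
    then obtain h where h: "\<And>n. sep (b n) (h n)"
      by metis
    have ob: "open (b n)" for n
      using rb B(2) unfolding B'_def by blast
    \<comment> \<open>Disjointify the cover, so that each point is governed by the first set containing it.\<close>
    define d where "d n = b n \<inter> - (\<Union>m<n. b m)" for n
    have fd: "fsigma_in euclidean (d n)" for n
      unfolding d_def using ob by (intro fsigma_open_Int_closed) (auto simp: closed_def)
    define H where "H = (\<Union>n. d n \<inter> h n)"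
    have cover: "\<exists>n. x \<in> d n" if "x \<in> W" for x
    proof -
      have "\<exists>n. x \<in> b n"
        using that rb unfolding W_def by blast
      then have "x \<in> b (LEAST n. x \<in> b n) \<and> (\<forall>m<(LEAST n. x \<in> b n). x \<notin> b m)"
        by (metis (no_types, lifting) LeastI not_less_Least)
      then show ?thesis
        unfolding d_def by blast
    qed
    have disj: "m = n" if "x \<in> d m" "x \<in> d n" for x m n
      using that unfolding d_def by (cases m n rule: linorder_cases) auto
    have dW: "d n \<subseteq> W" for n
      using rb unfolding d_def W_def by blast
    have "W - H = (\<Union>n. d n \<inter> (b n - h n))"
    proof (intro subset_antisym subsetI)
      fix x assume x: "x \<in> W - H"
      then obtain n where n: "x \<in> d n"
        using cover by blast
      then have "x \<in> b n" "x \<notin> h n"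
        using x unfolding d_def H_def by blast+
      then show "x \<in> (\<Union>n. d n \<inter> (b n - h n))"
        using n by blast
    next
      fix x assume "x \<in> (\<Union>n. d n \<inter> (b n - h n))"
      then obtain n where n: "x \<in> d n" "x \<notin> h n"
        by blast
      then have "x \<notin> H"
        unfolding H_def using disj by blast
      then show "x \<in> W - H"
        using n dW by blast
    qed
    moreover have "fsigma_in euclidean (\<Union>n. d n \<inter> (b n - h n))" "fsigma_in euclidean H"
      unfolding H_def using h fd unfolding sep_def
      by (auto intro!: fsigma_in_Union fsigma_in_Int)
    moreover have "P \<inter> W \<subseteq> H"
    proof
      fix x assume x: "x \<in> P \<inter> W"
      then obtain n where n: "x \<in> d n"
        using cover by blast
      then have "x \<in> h n"
        using x h[of n] unfolding d_def sep_def by blast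
      then show "x \<in> H"
        using n unfolding H_def by blast
    qed
    moreover have "H \<inter> Q = {}" "H \<subseteq> W"
      using h dW unfolding H_def sep_def by blast+
    ultimately have "sep W H"
      unfolding sep_def by simp
    then show ?thesis ..
  qed
  then obtain H where H: "sep W H" ..
  have "W = UNIV"
  proof (rule ccontr)
    assume "W \<noteq> UNIV"
    then obtain U where U: "open U" "U \<inter> - W \<noteq> {}" "U \<inter> - W \<inter> P = {} \<or> U \<inter> - W \<inter> Q = {}"
      using nd[of "- W"] openW by auto
    have f: "fsigma_in euclidean (U \<inter> - W)"
      using U(1) openW by (intro fsigma_open_Int_closed) (auto simp: closed_def)
    have o: "open (W \<union> U)"
      using openW U(1) by blast
    have "\<exists>K. sep (W \<union> U) K"
      using U(3)
    proof
      assume *: "U \<inter> - W \<inter> P = {}"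
      have "W \<union> U - H = (W - H) \<union> (U \<inter> - W)"
        using H unfolding sep_def by blast
      then have "sep (W \<union> U) H"
        using H f * unfolding sep_def by (auto intro!: fsigma_in_Un)
      then show ?thesis ..
    next
      assume *: "U \<inter> - W \<inter> Q = {}"
      have "W \<union> U - (H \<union> (U \<inter> - W)) = W - H"
        by blast
      then have "sep (W \<union> U) (H \<union> (U \<inter> - W))"
        using H f * unfolding sep_def by (auto intro!: fsigma_in_Un)
      then show ?thesis ..
    qed
    then show False
      using small[OF o] U(2) by blast
  qed
  then show thesis
    using that[of H] H unfolding sep_def ambiguous_def Compl_eq_Diff_UNIV by auto
qed

text \<open>
  Exhaust \<open>H\<close> and its complement by increasing sequences of closed sets; a Urysohn function for
  the \<open>n\<close>-th pair is eventually correct at each point.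
\<close>

lemma two_valued_ambiguous_limit:
  fixes H :: "'a::metric_space set" and c :: real
  assumes "ambiguous H" "0 \<le> c"
  obtains g :: "nat \<Rightarrow> 'a \<Rightarrow> real" where "\<And>n. continuous_on UNIV (g n)" "\<And>n x. \<bar>g n x\<bar> \<le> c"
    "\<And>x. (\<lambda>n. g n x) \<longlonglongrightarrow> (if x \<in> H then - c else c)"
proof -
  obtain S where S: "\<And>n. closed (S n)" "\<And>n. S n \<subseteq> S (Suc n)" "\<Union>(range S) = H"
    using assms(1) unfolding ambiguous_def fsigma_in_ascending by auto
  obtain R where R: "\<And>n. closed (R n)" "\<And>n. R n \<subseteq> R (Suc n)" "\<Union>(range R) = - H"
    using assms(1) unfolding ambiguous_def fsigma_in_ascending by auto
  have "\<exists>f. continuous_on UNIV f \<and> (\<forall>x. \<bar>f x\<bar> \<le> c) \<and> (\<forall>x\<in>S n. f x = - c) \<and> (\<forall>x\<in>R n. f x = c)" for n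
  proof -
    have "disjnt (S n) (R n)"
      using S(3) R(3) unfolding disjnt_def by blast
    then obtain f where f: "continuous_map euclidean euclideanreal f" "f ` S n \<subseteq> {- c}" "f ` R n \<subseteq> {c}"
      using Urysohn_lemma_alt[OF metrizable_imp_normal_space[OF metrizable_space_euclidean]] S(1) R(1)
      by (metis closed_closedin)
    let ?f = "\<lambda>x. max (- c) (min c (f x))"
    have "continuous_on UNIV ?f"
      using f(1) by (intro continuous_intros) simp_all
    moreover have "\<forall>x. \<bar>?f x\<bar> \<le> c"
      using assms(2) by auto
    moreover have "\<forall>x\<in>S n. ?f x = - c" "\<forall>x\<in>R n. ?f x = c"
      using f(2,3) assms(2) by auto
    ultimately show ?thesis by blast
  qed
  then obtain g where g: "\<And>n. continuous_on UNIV (g n)" "\<And>n x. \<bar>g n x\<bar> \<le> c"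
    "\<And>n x. x \<in> S n \<Longrightarrow> g n x = - c" "\<And>n x. x \<in> R n \<Longrightarrow> g n x = c"
    by metis
  have monoS: "S m \<subseteq> S n" and monoR: "R m \<subseteq> R n" if "m \<le> n" for m n
    using that S(2) R(2) by (metis lift_Suc_mono_le)+
  have "(\<lambda>n. g n x) \<longlonglongrightarrow> (if x \<in> H then - c else c)" for x
  proof (cases "x \<in> H")
    case True
    then obtain m where "x \<in> S m" using S(3) by blast
    then have "eventually (\<lambda>n. g n x = - c) sequentially"
      using monoS g(3) unfolding eventually_sequentially by blast
    then show ?thesis using True by (simp add: tendsto_eventually)
  next
    case False
    then obtain m where "x \<in> R m" using R(3) by blast
    then have "eventually (\<lambda>n. g n x = c) sequentially"
      using monoR g(4) unfolding eventually_sequentially by blast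
    then show ?thesis using False by (simp add: tendsto_eventually)
  qed
  with g that show thesis by blast
qed

text \<open>
  This is the form in which Baire class 1 is used: unlike the absence of oscillation on closed sets,
  it is visibly inherited by the remainders of an approximation by two-valued functions.
\<close>

definition separated_levels :: "('a::topological_space \<Rightarrow> real) \<Rightarrow> bool" where
  "separated_levels q \<longleftrightarrow> (\<forall>a b. a < b \<longrightarrow>
     (\<exists>H. ambiguous H \<and> (\<forall>x. q x < a \<longrightarrow> x \<in> H) \<and> (\<forall>x\<in>H. q x \<le> b)))"

text \<open>
  One step of an approximation in the style of Tietze: separating the levels \<open>\<plusminus>c/3\<close> by \<open>H\<close> and
  subtracting the corresponding two-valued function reduces the bound by the factor \<open>2/3\<close>. The
  remainder still has separated levels, because the two separations needed on \<open>H\<close> and off \<open>H\<close>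
  can be glued.
\<close>

lemma separated_levels_step:
  assumes q: "separated_levels q" and c: "0 < c" and bd: "\<And>x. \<bar>q x\<bar> \<le> c"
  obtains H where "ambiguous H" "separated_levels (\<lambda>x. q x - (if x \<in> H then - (c/3) else c/3))"
    "\<And>x. \<bar>q x - (if x \<in> H then - (c/3) else c/3)\<bar> \<le> 2/3 * c"
proof -
  have "- (c/3) < c/3"
    using c by simp
  then obtain H where H: "ambiguous H" "\<And>x. q x < - (c/3) \<Longrightarrow> x \<in> H" "\<And>x. x \<in> H \<Longrightarrow> q x \<le> c/3"
    using q unfolding separated_levels_def by meson
  let ?r = "\<lambda>x. q x - (if x \<in> H then - (c/3) else c/3)"
  have "\<bar>?r x\<bar> \<le> 2/3 * c" for x
  proof (cases "x \<in> H")
    case True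
    then show ?thesis
      using abs_le_D2[OF bd[of x]] H(3)[of x] by (intro abs_leI) auto
  next
    case False
    then have "- (c/3) \<le> q x"
      using H(2)[of x] by linarith
    then show ?thesis
      using False abs_le_D1[OF bd[of x]] by (intro abs_leI) auto
  qed
  moreover have "separated_levels ?r"
    unfolding separated_levels_def
  proof (intro allI impI)
    fix a b :: real assume ab: "a < b"
    then have l: "a - c/3 < b - c/3" "a + c/3 < b + c/3" by simp_all
    obtain K where K: "ambiguous K" "\<And>x. q x < a - c/3 \<Longrightarrow> x \<in> K" "\<And>x. x \<in> K \<Longrightarrow> q x \<le> b - c/3"
      using q l(1) unfolding separated_levels_def by meson
    obtain L where L: "ambiguous L" "\<And>x. q x < a + c/3 \<Longrightarrow> x \<in> L" "\<And>x. x \<in> L \<Longrightarrow> q x \<le> b + c/3"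
      using q l(2) unfolding separated_levels_def by meson
    show "\<exists>G. ambiguous G \<and> (\<forall>x. ?r x < a \<longrightarrow> x \<in> G) \<and> (\<forall>x\<in>G. ?r x \<le> b)"
    proof (intro exI conjI)
      show "ambiguous ((H \<inter> K) \<union> (L - H))"
        using ambiguous_glue H(1) K(1) L(1) by blast
      show "\<forall>x. ?r x < a \<longrightarrow> x \<in> (H \<inter> K) \<union> (L - H)"
        using K(2) L(2) by (auto simp: less_diff_eq diff_less_eq)
      show "\<forall>x\<in>(H \<inter> K) \<union> (L - H). ?r x \<le> b"
        using K(3) L(3) by (fastforce simp: le_diff_eq diff_le_eq)
    qed
  qed
  ultimately show thesis
    using that H(1) by blast
qed

text \<open>
  Iterating the step writes \<open>q\<close> as a series of two-valued functions with geometric bounds. Replacing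
  each term by its continuous approximations and cutting off the series diagonally is
  justified by Tannery's theorem.
\<close>

lemma separated_levels_imp_limit_of_continuous:
  fixes q :: "'a::metric_space \<Rightarrow> real"
  assumes q: "separated_levels q" and bd: "\<And>x. \<bar>q x\<bar> \<le> c"
  shows "\<exists>g::nat \<Rightarrow> 'a \<Rightarrow> real. (\<forall>n. continuous_on UNIV (g n)) \<and> (\<forall>x. (\<lambda>n. g n x) \<longlonglongrightarrow> q x)"
proof -
  define c' where "c' n = (2/3)^n * (\<bar>c\<bar> + 1)" for n :: nat
  have c'_pos: "c' n > 0" for n
    unfolding c'_def by simp
  have c'_Suc: "c' (Suc n) = 2/3 * c' n" for n
    unfolding c'_def by simp
  \<comment> \<open>\<open>r n\<close> is what remains of \<open>q\<close> after \<open>n\<close> corrections, and \<open>c' n\<close> bounds it.\<close>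
  define P where "P n r \<longleftrightarrow> separated_levels r \<and> (\<forall>x. \<bar>r x\<bar> \<le> c' n)" for n and r :: "'a \<Rightarrow> real"
  define Q where "Q n r r' \<longleftrightarrow> (\<exists>H. ambiguous H \<and> r' = (\<lambda>x. r x - (if x \<in> H then - (c' n/3) else c' n/3)))"
    for n and r r' :: "'a \<Rightarrow> real"
  have "\<exists>r. \<forall>n. P n (r n) \<and> Q n (r n) (r (Suc n)) \<and> (n = 0 \<longrightarrow> r n = q)"
  proof -
    have "\<exists>r. \<forall>n. (P n (r n) \<and> (n = 0 \<longrightarrow> r n = q)) \<and> Q n (r n) (r (Suc n))"
    proof (rule dependent_nat_choice)
      have "\<bar>q x\<bar> \<le> c' 0" for x
        using bd[of x] unfolding c'_def by simp
      then show "\<exists>r. P 0 r \<and> (0 = (0::nat) \<longrightarrow> r = q)"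
        using q unfolding P_def by blast
    next
      fix r n assume "P n r \<and> (n = 0 \<longrightarrow> r = q)"
      then have r: "separated_levels r" "\<And>x. \<bar>r x\<bar> \<le> c' n"
        unfolding P_def by auto
      obtain H where "ambiguous H" "separated_levels (\<lambda>x. r x - (if x \<in> H then - (c' n/3) else c' n/3))"
        "\<And>x. \<bar>r x - (if x \<in> H then - (c' n/3) else c' n/3)\<bar> \<le> 2/3 * c' n"
        using separated_levels_step[OF r(1) c'_pos r(2)] by blast
      then show "\<exists>r'. (P (Suc n) r' \<and> (Suc n = 0 \<longrightarrow> r' = q)) \<and> Q n r r'"
        unfolding P_def Q_def c'_Suc by blast
    qed
    then show ?thesis by blast
  qed
  then obtain r where r: "\<And>n. P n (r n)" "\<And>n. Q n (r n) (r (Suc n))" "r 0 = q"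
    by blast
  obtain H where H: "\<And>n. ambiguous (H n)"
    "\<And>n. r (Suc n) = (\<lambda>x. r n x - (if x \<in> H n then - (c' n/3) else c' n/3))"
    using r(2) unfolding Q_def by metis
  have "\<exists>g::nat \<Rightarrow> 'a \<Rightarrow> real. (\<forall>n. continuous_on UNIV (g n)) \<and> (\<forall>n x. \<bar>g n x\<bar> \<le> c' k/3)
      \<and> (\<forall>x. (\<lambda>n. g n x) \<longlonglongrightarrow> (if x \<in> H k then - (c' k/3) else c' k/3))" for k
    using two_valued_ambiguous_limit[OF H(1)[of k], of "c' k/3"] c'_pos[of k] by (metis divide_nonneg_pos less_eq_real_def zero_less_numeral)
  then obtain g :: "nat \<Rightarrow> nat \<Rightarrow> 'a \<Rightarrow> real" where g: "\<And>k n. continuous_on UNIV (g k n)"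
    "\<And>k n x. \<bar>g k n x\<bar> \<le> c' k/3"
    "\<And>k x. (\<lambda>n. g k n x) \<longlonglongrightarrow> (if x \<in> H k then - (c' k/3) else c' k/3)"
    by metis
  define G where "G n x = (\<Sum>k<n. g k n x)" for n x
  have "continuous_on UNIV (G n)" for n
    unfolding G_def using g(1) by (intro continuous_intros)
  moreover have "(\<lambda>n. G n x) \<longlonglongrightarrow> q x" for x
  proof -
    let ?a = "\<lambda>k n. if k < n then g k n x else 0"
    let ?b = "\<lambda>k. if x \<in> H k then - (c' k/3) else c' k/3"
    have c'0: "c' \<longlonglongrightarrow> 0"
      unfolding c'_def by (auto intro!: tendsto_mult_left_zero LIMSEQ_realpow_zero)
    have "(\<lambda>n. r n x) \<longlonglongrightarrow> 0"
    proof (rule Lim_null_comparison[OF _ c'0])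
      show "eventually (\<lambda>n. norm (r n x) \<le> c' n) sequentially"
        using r(1) unfolding P_def by simp
    qed
    then have "(\<lambda>n. r n x - r (Suc n) x) sums (r 0 x - 0)"
      by (rule telescope_sums')
    moreover have "(\<lambda>n. r n x - r (Suc n) x) = ?b"
      using H(2) by (auto simp: fun_eq_iff)
    ultimately have sb: "suminf ?b = q x"
      using r(3) sums_unique by fastforce
    have "(\<lambda>n. suminf (\<lambda>k. ?a k n)) \<longlonglongrightarrow> suminf ?b"
    proof -
      have 1: "((\<lambda>n. ?a k n) \<longlongrightarrow> ?b k) sequentially" for k
      proof (rule Lim_transform_eventually[OF g(3)])
        show "eventually (\<lambda>n. g k n x = ?a k n) sequentially"
          using eventually_gt_at_top[of k] by eventually_elim simp
      qed
      have 2: "eventually (\<lambda>(k,n). norm (?a k n) \<le> c' k / 3) (at_top \<times>\<^sub>F sequentially)"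
        using g(2) c'_pos by (auto intro!: always_eventually simp: less_imp_le)
      have 3: "summable (\<lambda>k. c' k / 3)"
        unfolding c'_def by (intro summable_divide summable_mult2 summable_geometric) auto
      show ?thesis
        using tannerys_theorem[OF 1 2 3] by simp
    qed
    moreover have "suminf (\<lambda>k. ?a k n) = G n x" for n
    proof -
      have "suminf (\<lambda>k. ?a k n) = (\<Sum>k<n. ?a k n)"
        by (rule suminf_finite) auto
      also have "\<dots> = G n x"
        unfolding G_def by (rule sum.cong) auto
      finally show ?thesis .
    qed
    ultimately show ?thesis
      using sb by simp
  qed
  ultimately show ?thesis by blast
qed

lemma non_limit_of_continuous_oscillates:
  fixes q :: "'a::metric_space \<Rightarrow> real"
  assumes cpt: "compact (UNIV :: 'a set)" and bd: "\<And>x. \<bar>q x\<bar> \<le> c"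
    and nb: "\<not> (\<exists>g::nat \<Rightarrow> 'a \<Rightarrow> real. (\<forall>n. continuous_on UNIV (g n)) \<and> (\<forall>x. (\<lambda>n. g n x) \<longlonglongrightarrow> q x))"
  obtains a b C where "a < b" "closed C" "C \<noteq> {}"
    "\<And>U. open U \<Longrightarrow> U \<inter> C \<noteq> {} \<Longrightarrow> (\<exists>x\<in>U \<inter> C. q x < a) \<and> (\<exists>x\<in>U \<inter> C. b < q x)"
proof -
  have "\<exists>a b C. a < b \<and> closed C \<and> C \<noteq> {} \<and>
      (\<forall>U. open U \<longrightarrow> U \<inter> C \<noteq> {} \<longrightarrow> (\<exists>x\<in>U \<inter> C. q x < a) \<and> (\<exists>x\<in>U \<inter> C. b < q x))" (is ?osc)
  proof (rule ccontr)
    assume neg: "\<not> ?osc"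
    have "separated_levels q"
      unfolding separated_levels_def
    proof (intro allI impI)
      fix a b :: real assume ab: "a < b"
      have "\<exists>U. open U \<and> U \<inter> C \<noteq> {} \<and> (U \<inter> C \<inter> {x. q x < a} = {} \<or> U \<inter> C \<inter> {x. b < q x} = {})"
        if C: "closed C" "C \<noteq> {}" for C
      proof -
        have "\<not> (\<forall>U. open U \<longrightarrow> U \<inter> C \<noteq> {} \<longrightarrow> (\<exists>x\<in>U \<inter> C. q x < a) \<and> (\<exists>x\<in>U \<inter> C. b < q x))"
        proof
          assume "\<forall>U. open U \<longrightarrow> U \<inter> C \<noteq> {} \<longrightarrow> (\<exists>x\<in>U \<inter> C. q x < a) \<and> (\<exists>x\<in>U \<inter> C. b < q x)"
          with ab C have ?osc
            by (intro exI[of _ a] exI[of _ b] exI[of _ C] conjI)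
          with neg show False ..
        qed
        then obtain U where "\<not> (open U \<longrightarrow> U \<inter> C \<noteq> {} \<longrightarrow> (\<exists>x\<in>U \<inter> C. q x < a) \<and> (\<exists>x\<in>U \<inter> C. b < q x))"
          unfolding not_all by (elim exE)
        then show ?thesis
          by (intro exI[of _ U]) auto
      qed
      then obtain H where "ambiguous H" "{x. q x < a} \<subseteq> H" "H \<inter> {x. b < q x} = {}"
        using ambiguous_separation[OF cpt, of "{x. q x < a}" "{x. b < q x}"] by metis
      then show "\<exists>H. ambiguous H \<and> (\<forall>x. q x < a \<longrightarrow> x \<in> H) \<and> (\<forall>x\<in>H. q x \<le> b)"
        by (intro exI[of _ H]) (auto simp: not_less[symmetric])
    qed
    then show False
      using separated_levels_imp_limit_of_continuous[of q c] bd nb by blast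
  qed
  then show thesis
    using that by blast
qed

section \<open>Essential supports and irregularity witnesses\<close>

text \<open>
  \<open>C\<close> is the essential support of \<open>D\<close>: the basic open sets that meet \<open>D\<close> in a null set are removed.
\<close>

lemma essential_closed_subset:
  fixes M :: "'a::metric_space measure"
  assumes cpt: "compact (UNIV :: 'a set)" and M: "finite_measure M" and sets: "sets M = sets borel"
    and D: "D \<in> sets M" "0 < measure M D"
  obtains C where "closed C" "C \<noteq> {}" "\<And>U. open U \<Longrightarrow> U \<inter> C \<noteq> {} \<Longrightarrow> 0 < measure M (U \<inter> D \<inter> C)"
proof -
  interpret finite_measure M by fact
  obtain B :: "'a set set" where B: "countable B" "\<And>b. b \<in> B \<Longrightarrow> open b"
    "\<And>U x. open U \<Longrightarrow> x \<in> U \<Longrightarrow> \<exists>b\<in>B. x \<in> b \<and> b \<subseteq> U"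
    using countable_base_of_compact[OF cpt] by blast
  define B0 where "B0 = {b\<in>B. measure M (b \<inter> D) = 0}"
  define C where "C = - \<Union>B0"
  have opn: "open b" if "b \<in> B0" for b
    using that B(2) unfolding B0_def by blast
  have in_sets: "U \<in> sets M" if "open U" for U
    using that sets by simp
  have "(\<Union>b\<in>B0. b \<inter> D) \<in> null_sets M"
  proof (rule null_sets_UN')
    show "countable B0"
      using B(1) unfolding B0_def by simp
    show "b \<inter> D \<in> null_sets M" if "b \<in> B0" for b
      using that D(1) in_sets[OF opn[OF that]] unfolding B0_def by (auto simp: null_sets_def emeasure_eq_measure)
  qed
  moreover have "(\<Union>b\<in>B0. b \<inter> D) = D - C"
    unfolding C_def by blast
  ultimately have null: "D - C \<in> null_sets M" by simp
  have clC: "closed C"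
    unfolding C_def using opn by (simp add: open_Union closed_Compl)
  then have C: "C \<in> sets M"
    using sets by simp
  have eq: "measure M (U \<inter> D \<inter> C) = measure M (U \<inter> D)" if "open U" for U
  proof -
    have "U \<inter> D \<inter> C = U \<inter> D - (D - C)"
      by blast
    then show ?thesis
      using null D(1) in_sets[OF that] by (simp add: measure_Diff_null_set)
  qed
  show thesis
  proof
    show "closed C" by (rule clC)
    show "C \<noteq> {}"
      using eq[of UNIV] D(2) by auto
    fix U assume U: "open U" "U \<inter> C \<noteq> {}"
    then obtain x where "x \<in> U" "x \<in> C" by blast
    then obtain b where b: "b \<in> B" "x \<in> b" "b \<subseteq> U"
      using B(3)[OF U(1)] by blast
    have "b \<notin> B0"
      using b(2) \<open>x \<in> C\<close> unfolding C_def by blast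
    then have "0 < measure M (b \<inter> D)"
      using b(1) unfolding B0_def by (simp add: zero_less_measure_iff)
    also have "\<dots> \<le> measure M (U \<inter> D)"
      using b(3) D(1) in_sets[OF U(1)] in_sets[OF B(2)[OF b(1)]] by (intro finite_measure_mono) auto
    finally show "0 < measure M (U \<inter> D \<inter> C)"
      unfolding eq[OF U(1)] .
  qed
qed

text \<open>
  Given finitely many open sets meeting the essential support, the tuples with two entries from
  each of them form a box of positive measure, so one of these tuples is shattered. A function
  that is low exactly at the first entry of every pair then splits all the open sets.
\<close>

lemma witness_imp_splitting_set:
  fixes M :: "'a::metric_space measure"
  assumes cpt: "compact (UNIV :: 'a set)" and M: "prob_space M" and sets: "sets M = sets borel"
    and w: "irregularity_witness M Z \<alpha> \<beta> A" and pos: "emeasure (completion M) A \<noteq> 0"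
  obtains C where "splitting_set Z \<alpha> \<beta> C"
proof -
  interpret prob_space M by fact
  have A: "A \<in> sets (completion M)"
    and sh: "\<And>n. AE x in PiM {..<n} (\<lambda>_. M). x \<in> ({..<n} \<rightarrow>\<^sub>E A) \<longrightarrow> x \<in> shattered_tuples Z \<alpha> \<beta> n"
    using w unfolding irregularity_witness_def by auto
  define D where "D = main_part M A"
  have D: "D \<in> sets M" "D \<subseteq> A"
    unfolding D_def using A main_part_null_part_Un[OF A] by (simp, blast)
  have "emeasure M D \<noteq> 0"
    using pos A unfolding D_def by simp
  then have "0 < measure M D"
    by (simp add: emeasure_eq_measure zero_less_measure_iff)
  then obtain C where C: "closed C" "C \<noteq> {}" "\<And>U. open U \<Longrightarrow> U \<inter> C \<noteq> {} \<Longrightarrow> 0 < measure M (U \<inter> D \<inter> C)"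
    using essential_closed_subset[OF cpt finite_measure_axioms sets D(1)] by blast
  have "splitting_set Z \<alpha> \<beta> C"
    unfolding splitting_set_def
  proof (intro conjI allI impI)
    fix \<U> :: "'a set set" assume \<U>: "finite \<U>" "\<forall>U\<in>\<U>. open U \<and> U \<inter> C \<noteq> {}"
    obtain e where e: "bij_betw e {..<card \<U>} \<U>"
      using ex_bij_betw_nat_finite[OF \<U>(1)] by (auto simp: atLeast0LessThan)
    \<comment> \<open>Coordinates 2j and 2j+1 both sample the j-th open set.\<close>
    define n where "n = 2 * card \<U>"
    define E where "E i = e (i div 2) \<inter> D \<inter> C" for i
    have eU: "e (i div 2) \<in> \<U>" if "i < n" for i
      using that e unfolding n_def by (intro bij_betwE[OF e, rule_format]) auto
    have E: "E i \<in> sets M" "0 < measure M (E i)" if "i < n" for i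
      using eU[OF that] \<U>(2) C D(1) sets unfolding E_def by (auto intro!: sets.Int)
    interpret PP: product_prob_space "\<lambda>_::nat. M" "{..<n}"
      by (intro product_prob_spaceI) (rule prob_space_axioms)
    have "emeasure (PiM {..<n} (\<lambda>_. M)) (Pi\<^sub>E {..<n} E) = (\<Prod>i<n. emeasure M (E i))"
      using E(1) by (intro PP.emeasure_PiM) auto
    moreover have "(\<Prod>i<n. emeasure M (E i)) \<noteq> 0"
      using E(2) by (fastforce simp: emeasure_eq_measure prod_zero_iff)
    ultimately have "Pi\<^sub>E {..<n} E \<notin> null_sets (PiM {..<n} (\<lambda>_. M))"
      by auto
    moreover have "Pi\<^sub>E {..<n} E \<in> sets (PiM {..<n} (\<lambda>_. M))"
      using E(1) by (intro sets_PiM_I_finite) auto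
    ultimately have "\<not> (AE x in PiM {..<n} (\<lambda>_. M). x \<notin> Pi\<^sub>E {..<n} E)"
      using AE_iff_null_sets by blast
    then have "\<exists>x. x \<in> Pi\<^sub>E {..<n} E \<and> (x \<in> ({..<n} \<rightarrow>\<^sub>E A) \<longrightarrow> x \<in> shattered_tuples Z \<alpha> \<beta> n)"
      using sh[of n] by (metis (mono_tags, lifting) AE_mp AE_I2)
    moreover have "Pi\<^sub>E {..<n} E \<subseteq> {..<n} \<rightarrow>\<^sub>E A"
      using D(2) unfolding E_def by (intro PiE_mono) auto
    ultimately obtain x where x: "x \<in> Pi\<^sub>E {..<n} E" "x \<in> shattered_tuples Z \<alpha> \<beta> n"
      by blast
    have inj: "inj_on x {..<n}" and shat: "shattered Z \<alpha> \<beta> (x ` {..<n})"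
      using x(2) unfolding shattered_tuples_def by auto
    have "x ` {i\<in>{..<n}. even i} \<subseteq> x ` {..<n}"
      by auto
    then obtain f where f: "f \<in> Z" "\<And>y. y \<in> x ` {i\<in>{..<n}. even i} \<Longrightarrow> f y < \<alpha>"
      "\<And>y. y \<in> x ` {..<n} - x ` {i\<in>{..<n}. even i} \<Longrightarrow> \<beta> < f y"
      using shat unfolding shattered_def by meson
    show "\<exists>f\<in>Z. \<forall>U\<in>\<U>. \<forall>b. U \<inter> C \<inter> side \<alpha> \<beta> f b \<noteq> {}"
    proof (intro bexI[OF _ f(1)] ballI allI)
      fix U b assume "U \<in> \<U>"
      then obtain j where j: "j < card \<U>" "U = e j"
        using e unfolding bij_betw_def by auto
      define i where "i = 2 * j + (if b then 1 else 0)"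
      have i: "i < n" "i div 2 = j" "even i \<longleftrightarrow> \<not> b"
        using j(1) unfolding i_def n_def by auto
      have "x i \<in> U \<inter> C"
        using x(1) i j unfolding E_def by (auto simp: PiE_def Pi_def)
      moreover have "x i \<in> side \<alpha> \<beta> f b"
      proof (cases b)
        case False
        then show ?thesis
          using f(2)[of "x i"] i by (auto simp: side_def)
      next
        case True
        then have "x i \<notin> x ` {i\<in>{..<n}. even i}"
          using inj i by (auto simp: inj_on_def)
        then show ?thesis
          using f(3)[of "x i"] i True by (auto simp: side_def)
      qed
      ultimately show "U \<inter> C \<inter> side \<alpha> \<beta> f b \<noteq> {}"
        by blast
    qed
  qed (use C in auto)
  then show thesis
    by (rule that)
qed

section \<open>A strong law of large numbers for bounded functions\<close>

text \<open>
  For bounded functions Hoeffding's inequality bounds the deviation probabilities by a geometric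
  sequence, so the first Borel-Cantelli lemma suffices.
\<close>

lemma strong_law_bounded:
  fixes h :: "'a \<Rightarrow> real"
  assumes M: "prob_space M" and h[measurable]: "h \<in> borel_measurable M"
    and bd: "\<And>x. x \<in> space M \<Longrightarrow> \<bar>h x\<bar> \<le> B"
  shows "AE \<omega> in PiM (UNIV :: nat set) (\<lambda>_. M). (\<lambda>N. (\<Sum>k<N. h (\<omega> k)) / real N) \<longlonglongrightarrow> integral\<^sup>L M h"
proof -
  interpret M: prob_space M by fact
  let ?P = "PiM (UNIV :: nat set) (\<lambda>_. M)"
  interpret P: prob_space ?P
    by (rule prob_space_PiM) (rule M)
  interpret PP: product_prob_space "\<lambda>_::nat. M" UNIV
    by (intro product_prob_spaceI) (rule M)
  define C where "C = \<bar>B\<bar> + 1"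
  have C: "C > 0" "\<And>x. x \<in> space M \<Longrightarrow> \<bar>h x\<bar> \<le> C"
    unfolding C_def using bd by force+
  have comp: "distr ?P M (\<lambda>\<omega>. \<omega> k) = M" for k
    by (rule PP.PiM_component) simp
  have distr_h: "distr ?P borel (\<lambda>\<omega>. h (\<omega> k)) = distr M borel h" for k
    by (subst (2) comp[of k, symmetric]) (simp add: distr_distr comp_def)
  have exp_h: "P.expectation (\<lambda>\<omega>. h (\<omega> k)) = integral\<^sup>L M h" for k
  proof -
    have "integral\<^sup>L (distr ?P M (\<lambda>\<omega>. \<omega> k)) h = P.expectation (\<lambda>\<omega>. h (\<omega> k))"
      by (rule integral_distr) simp_all
    then show ?thesis by (simp add: comp)
  qed
  let ?A = "\<lambda>\<epsilon> N. {\<omega>\<in>space ?P. \<epsilon> \<le> \<bar>(\<Sum>k<N. h (\<omega> k)) / real N - integral\<^sup>L M h\<bar>}"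
  have tail: "P.prob (?A \<epsilon> N) \<le> 2 * exp (- 2 * real N * \<epsilon>\<^sup>2 / (C - - C)\<^sup>2)" if "\<epsilon> > 0" "N > 0" for \<epsilon> N
  proof -
    have ne: "{..<N} \<noteq> {}"
      using that by auto
    have "P.indep_vars (\<lambda>_. M) (\<lambda>i \<omega>. \<omega> i) {..<N}"
      using ne PP.distr_PiM_restrict_finite[of "{..<N}"]
      by (subst P.indep_vars_iff_distr_eq_PiM') (simp_all add: comp)
    then have ind: "P.indep_vars (\<lambda>_. borel) (\<lambda>i \<omega>. h (\<omega> i)) {..<N}"
      by (rule P.indep_vars_compose2) simp
    interpret H: Hoeffding_ineq_iid ?P "{..<N}" "\<lambda>i \<omega>. h (\<omega> i)" "\<lambda>\<omega>. h (\<omega> 0)" "- C" C "P.expectation (\<lambda>\<omega>. h (\<omega> 0))"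
    proof unfold_locales
      show "AE \<omega> in ?P. h (\<omega> 0) \<in> {- C..C}"
      proof (rule AE_I2)
        fix \<omega> assume "\<omega> \<in> space ?P"
        then have "\<omega> 0 \<in> space M"
          by (auto simp: space_PiM)
        then show "h (\<omega> 0) \<in> {- C..C}"
          using C(2)[of "\<omega> 0"] by auto
      qed
    qed (simp_all add: ind distr_h)
    show ?thesis
      using H.Hoeffding_ineq_abs_ge'[of \<epsilon>] that C(1) ne by (simp add: exp_h)
  qed
  have ev: "AE \<omega> in ?P. eventually (\<lambda>N. \<bar>(\<Sum>k<N. h (\<omega> k)) / real N - integral\<^sup>L M h\<bar> < \<epsilon>) sequentially"
    if \<epsilon>: "\<epsilon> > 0" for \<epsilon>
  proof -
    define q where "q = exp (- 2 * \<epsilon>\<^sup>2 / (C - - C)\<^sup>2)"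
    have q: "0 < q" "q < 1"
      unfolding q_def using \<epsilon> C(1) by auto
    have "2 * exp (- 2 * real N * \<epsilon>\<^sup>2 / (C - - C)\<^sup>2) = 2 * q ^ N" for N
      unfolding q_def by (simp add: exp_of_nat_mult[symmetric] algebra_simps)
    then have le: "P.prob (?A \<epsilon> N) \<le> 2 * q ^ N" if "N > 0" for N
      using tail[OF \<epsilon> that] by simp
    have meas: "?A \<epsilon> N \<in> sets ?P" for N
      by measurable
    have "summable (\<lambda>N. P.prob (?A \<epsilon> N))"
    proof (rule summable_comparison_test_ev)
      show "eventually (\<lambda>N. norm (P.prob (?A \<epsilon> N)) \<le> 2 * q ^ N) sequentially"
        using eventually_gt_at_top[of 0] by eventually_elim (use le in simp)
      show "summable (\<lambda>N. 2 * q ^ N)"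
        using q by (intro summable_mult summable_geometric) simp
    qed
    then have "AE \<omega> in ?P. eventually (\<lambda>N. \<omega> \<in> space ?P - ?A \<epsilon> N) sequentially"
      using meas by (intro borel_cantelli_AE1) (auto simp: less_top[symmetric])
    then show ?thesis
    proof eventually_elim
      case (elim \<omega>)
      then show ?case
        by eventually_elim auto
    qed
  qed
  have "AE \<omega> in ?P. \<forall>j::nat. eventually (\<lambda>N. \<bar>(\<Sum>k<N. h (\<omega> k)) / real N - integral\<^sup>L M h\<bar> < 1 / real (Suc j)) sequentially"
    unfolding AE_all_countable using ev by simp
  then show ?thesis
  proof eventually_elim
    case (elim \<omega>)
    show ?case
      unfolding tendsto_iff dist_real_def
    proof (intro allI impI)
      fix e :: real assume "e > 0"
      then obtain j where "1 / real (Suc j) < e"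
        using nat_approx_posE by blast
      then show "eventually (\<lambda>N. \<bar>(\<Sum>k<N. h (\<omega> k)) / real N - integral\<^sup>L M h\<bar> < e) sequentially"
        using elim by (auto elim!: allE[of _ j] eventually_mono)
    qed
  qed
qed

section \<open>Bracketing\<close>

definition envelope_gap :: "('a \<Rightarrow> real) set \<Rightarrow> 'a \<Rightarrow> real" where
  "envelope_gap Y x = (SUP f\<in>Y. f x) - (INF f\<in>Y. f x)"

text \<open>
  Finitely many classes cover the family, each of them with upper and lower envelope within \<open>\<eta>\<close> of
  each other in the mean; the envelopes are the brackets. The classes are nonempty because the
  envelopes of the empty class are unspecified.
\<close>

definition bracketable :: "'a measure \<Rightarrow> real \<Rightarrow> ('a \<Rightarrow> real) set \<Rightarrow> bool" where
  "bracketable M \<eta> Y \<longleftrightarrow> (\<exists>\<P>. finite \<P> \<and> Y \<subseteq> \<Union>\<P> \<and>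
     (\<forall>Y'\<in>\<P>. Y' \<noteq> {} \<and> Y' \<subseteq> Y \<and> integral\<^sup>L M (envelope_gap Y') \<le> \<eta>))"

lemma bracketable_empty: "bracketable M \<eta> {}"
  unfolding bracketable_def by (intro exI[of _ "{}"]) simp

text \<open>
  In other words, the families without a finite bracketing form a partition regular collection:
  if such a family is divided into finitely many parts, one part has none either.
\<close>

lemma bracketable_Union:
  assumes "finite \<Q>" "Y = \<Union>\<Q>" "\<And>Q. Q \<in> \<Q> \<Longrightarrow> bracketable M \<eta> Q"
  shows "bracketable M \<eta> Y"
proof -
  obtain \<P> where \<P>: "\<And>Q. Q \<in> \<Q> \<Longrightarrow> finite (\<P> Q) \<and> Q \<subseteq> \<Union>(\<P> Q) \<and>
     (\<forall>Y'\<in>\<P> Q. Y' \<noteq> {} \<and> Y' \<subseteq> Q \<and> integral\<^sup>L M (envelope_gap Y') \<le> \<eta>)"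
    using assms(3) unfolding bracketable_def by metis
  show ?thesis
    unfolding bracketable_def
  proof (intro exI[of _ "\<Union>Q\<in>\<Q>. \<P> Q"] conjI ballI)
    show "finite (\<Union>Q\<in>\<Q>. \<P> Q)"
      using assms(1) \<P> by blast
    show "Y \<subseteq> \<Union>(\<Union>Q\<in>\<Q>. \<P> Q)"
      unfolding assms(2) using \<P> by fastforce
    fix Y' assume "Y' \<in> (\<Union>Q\<in>\<Q>. \<P> Q)"
    then obtain Q where Q: "Q \<in> \<Q>" "Y' \<in> \<P> Q" by blast
    then show "Y' \<noteq> {}" "integral\<^sup>L M (envelope_gap Y') \<le> \<eta>"
      using \<P> by blast+
    have "Y' \<subseteq> Q"
      using \<P> Q by blast
    then show "Y' \<subseteq> Y"
      using Q(1) unfolding assms(2) by blast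
  qed
qed

locale bounded_countable_family = prob_space M for M :: "'a measure" +
  fixes Z :: "('a \<Rightarrow> real) set" and B :: real
  assumes countable_Z: "countable Z"
    and measurable_Z: "\<And>f. f \<in> Z \<Longrightarrow> f \<in> borel_measurable M"
    and bounded_Z: "\<And>f x. f \<in> Z \<Longrightarrow> \<bar>f x\<bar> \<le> B"
begin

abbreviation upper :: "('a \<Rightarrow> real) set \<Rightarrow> 'a \<Rightarrow> real" where "upper Y x \<equiv> (SUP f\<in>Y. f x)"
abbreviation lower :: "('a \<Rightarrow> real) set \<Rightarrow> 'a \<Rightarrow> real" where "lower Y x \<equiv> (INF f\<in>Y. f x)"

lemma bdd_family:
  assumes "Y \<subseteq> Z"
  shows "bdd_above ((\<lambda>f. f x) ` Y)" "bdd_below ((\<lambda>f. f x) ` Y)"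
  using bounded_Z[of _ x] assms
  by (auto intro!: bdd_aboveI2[of _ _ B] bdd_belowI2[of _ "- B"] simp: abs_le_iff)
     (metis abs_le_D2 minus_le_iff subsetD)

lemma envelope_bounds:
  assumes "Y \<subseteq> Z" "f \<in> Y"
  shows "lower Y x \<le> f x" "f x \<le> upper Y x" "- B \<le> lower Y x" "upper Y x \<le> B"
proof -
  show "lower Y x \<le> f x" "f x \<le> upper Y x"
    using bdd_family[OF assms(1)] assms(2) by (auto intro: cINF_lower cSUP_upper)
  have "Y \<noteq> {}"
    using assms(2) by blast
  then show "- B \<le> lower Y x"
    using assms(1) bounded_Z[of _ x] by (intro cINF_greatest) (auto simp: abs_le_iff minus_le_iff)
  show "upper Y x \<le> B"
    using assms(1) bounded_Z[of _ x] \<open>Y \<noteq> {}\<close> by (intro cSUP_least) (auto simp: abs_le_iff)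
qed

lemma envelope_abs_le:
  assumes "Y \<subseteq> Z" "Y \<noteq> {}"
  shows "\<bar>upper Y x\<bar> \<le> B" "\<bar>lower Y x\<bar> \<le> B"
proof -
  obtain f where "f \<in> Y" using assms(2) by blast
  from envelope_bounds[OF assms(1) this, of x] show "\<bar>upper Y x\<bar> \<le> B" "\<bar>lower Y x\<bar> \<le> B"
    by linarith+
qed

lemma envelope_measurable:
  assumes "Y \<subseteq> Z"
  shows "upper Y \<in> borel_measurable M" "lower Y \<in> borel_measurable M"
proof -
  have "countable Y"
    using assms countable_Z by (rule countable_subset)
  then show "upper Y \<in> borel_measurable M" "lower Y \<in> borel_measurable M"
    using assms measurable_Z bdd_family[OF assms]
    by (auto intro!: borel_measurable_cSUP borel_measurable_cINF)
qed

lemma envelope_integrable: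
  assumes "Y \<subseteq> Z" "Y \<noteq> {}"
  shows "integrable M (upper Y)" "integrable M (lower Y)" "integrable M (envelope_gap Y)"
proof -
  show 1: "integrable M (upper Y)"
    by (rule integrable_const_bound[of _ B]) (use envelope_abs_le[OF assms] envelope_measurable[OF assms(1)] in auto)
  show 2: "integrable M (lower Y)"
    by (rule integrable_const_bound[of _ B]) (use envelope_abs_le[OF assms] envelope_measurable[OF assms(1)] in auto)
  show "integrable M (envelope_gap Y)"
    unfolding envelope_gap_def[abs_def] using 1 2 by (rule Bochner_Integration.integrable_diff)
qed

lemma integrable_Z: "f \<in> Z \<Longrightarrow> integrable M f"
  by (rule integrable_const_bound[of _ B]) (use bounded_Z measurable_Z in auto)

text \<open>
  If the strong law holds for the finitely many envelopes, then every empirical mean in a class is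
  caught between those of the envelopes, whose integrals differ little.
\<close>

lemma bracketable_imp_glivenko_cantelli:
  assumes br: "\<And>\<eta>. \<eta> > 0 \<Longrightarrow> bracketable M \<eta> Z"
  shows "glivenko_cantelli M Z"
  unfolding glivenko_cantelli_def
proof (intro conjI ballI)
  show "integrable M f" if "f \<in> Z" for f
    using that by (rule integrable_Z)
  let ?P = "PiM (UNIV :: nat set) (\<lambda>_. M)"
  have "\<exists>\<P>. finite \<P> \<and> Z \<subseteq> \<Union>\<P> \<and>
     (\<forall>Y\<in>\<P>. Y \<noteq> {} \<and> Y \<subseteq> Z \<and> integral\<^sup>L M (envelope_gap Y) \<le> 1 / real (Suc j))" for j
    using br[of "1 / real (Suc j)"] unfolding bracketable_def by simp
  then obtain \<P> where \<P>: "\<And>j. finite (\<P> j)" "\<And>j. Z \<subseteq> \<Union>(\<P> j)"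
    "\<And>j Y. Y \<in> \<P> j \<Longrightarrow> Y \<noteq> {} \<and> Y \<subseteq> Z \<and> integral\<^sup>L M (envelope_gap Y) \<le> 1 / real (Suc j)"
    by metis
  define avg where "avg h \<omega> N = (\<Sum>k<N. h (\<omega> k)) / real N" for h :: "'a \<Rightarrow> real" and \<omega> :: "nat \<Rightarrow> 'a" and N
  have lln: "AE \<omega> in ?P. (avg (upper Y) \<omega> \<longlonglongrightarrow> integral\<^sup>L M (upper Y)) \<and> (avg (lower Y) \<omega> \<longlonglongrightarrow> integral\<^sup>L M (lower Y))"
    if "Y \<in> \<P> j" for Y j
  proof -
    have Y: "Y \<subseteq> Z" "Y \<noteq> {}"
      using \<P>(3)[OF that] by auto
    show ?thesis
      unfolding avg_def[abs_def]
      by (intro AE_conjI strong_law_bounded[where B = B] prob_space_axioms envelope_measurable[OF Y(1)] envelope_abs_le[OF Y])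
  qed
  have "AE \<omega> in ?P. \<forall>j. \<forall>Y\<in>\<P> j. (avg (upper Y) \<omega> \<longlonglongrightarrow> integral\<^sup>L M (upper Y)) \<and> (avg (lower Y) \<omega> \<longlonglongrightarrow> integral\<^sup>L M (lower Y))"
    unfolding AE_all_countable by (intro allI AE_finite_allI \<P>(1) lln)
  then show "AE \<omega> in ?P. (\<lambda>N. SUP f\<in>Z. ennreal \<bar>(\<Sum>k<N. f (\<omega> k)) / real N - integral\<^sup>L M f\<bar>) \<longlonglongrightarrow> 0"
  proof eventually_elim
    case (elim \<omega>)
    have key: "eventually (\<lambda>N. (SUP f\<in>Z. ennreal \<bar>avg f \<omega> N - integral\<^sup>L M f\<bar>) \<le> ennreal e) sequentially" if "e > 0" for e
    proof -
      obtain j where j: "1 / real (Suc j) < e / 2"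
        using nat_approx_posE[of "e / 2"] \<open>e > 0\<close> by auto
      have "eventually (\<lambda>N. \<forall>Y\<in>\<P> j. avg (upper Y) \<omega> N < integral\<^sup>L M (upper Y) + e / 2
          \<and> integral\<^sup>L M (lower Y) - e / 2 < avg (lower Y) \<omega> N) sequentially"
        using elim \<open>e > 0\<close>
        by (intro eventually_ball_finite \<P>(1) ballI eventually_conj) (auto intro!: order_tendstoD)
      then show ?thesis
      proof eventually_elim
        case (elim N)
        show ?case
        proof (rule SUP_least)
          fix f assume f: "f \<in> Z"
          then obtain Y where Y: "Y \<in> \<P> j" "f \<in> Y"
            using \<P>(2) by blast
          then have YZ: "Y \<subseteq> Z" "Y \<noteq> {}"
            using \<P>(3) by blast+
          note eb = envelope_bounds[OF YZ(1) Y(2)]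
          note ei = envelope_integrable[OF YZ]
          have avg_mono: "avg g \<omega> N \<le> avg h \<omega> N" if "\<And>x. g x \<le> h x" for g h
            unfolding avg_def using that by (intro divide_right_mono sum_mono) auto
          have "integral\<^sup>L M (envelope_gap Y) = integral\<^sup>L M (upper Y) - integral\<^sup>L M (lower Y)"
            unfolding envelope_gap_def[abs_def] using ei by simp
          then have gap: "integral\<^sup>L M (upper Y) - integral\<^sup>L M (lower Y) < e / 2"
            using \<P>(3)[OF Y(1)] j by linarith
          have "integral\<^sup>L M (lower Y) \<le> integral\<^sup>L M f" "integral\<^sup>L M f \<le> integral\<^sup>L M (upper Y)"
            using ei integrable_Z[OF f] eb by (auto intro!: integral_mono)
          moreover have "avg (lower Y) \<omega> N \<le> avg f \<omega> N" "avg f \<omega> N \<le> avg (upper Y) \<omega> N"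
            using eb by (auto intro!: avg_mono)
          ultimately have "\<bar>avg f \<omega> N - integral\<^sup>L M f\<bar> \<le> e"
            using gap elim[rule_format, OF Y(1)] by linarith
          then show "ennreal \<bar>avg f \<omega> N - integral\<^sup>L M f\<bar> \<le> ennreal e"
            by (rule ennreal_leI)
        qed
      qed
    qed
    have "(\<lambda>N. SUP f\<in>Z. ennreal \<bar>avg f \<omega> N - integral\<^sup>L M f\<bar>) \<longlonglongrightarrow> 0"
    proof (rule order_tendstoI)
      fix a :: ennreal assume "0 < a"
      then obtain b where b: "0 < b" "b < a"
        using dense by blast
      then obtain e where e: "b = ennreal e" "0 \<le> e"
        by (cases b) auto
      then have "e > 0"
        using b(1) by (cases "e = 0") auto
      from key[OF this] show "eventually (\<lambda>N. (SUP f\<in>Z. ennreal \<bar>avg f \<omega> N - integral\<^sup>L M f\<bar>) < a) sequentially"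
        by eventually_elim (use b(2) e(1) in auto)
    qed simp
    then show ?case
      unfolding avg_def .
  qed
qed

text \<open>
  Near-minimality is required among the subfamilies of the preceding member only. This is what a
  greedy choice provides, and it is enough because later competitors are contained in it.
\<close>

lemma exists_nearly_minimal_chain:
  assumes \<eta>: "\<not> bracketable M \<eta> Z"
  obtains Y where "\<And>n. Y n \<subseteq> Z" "\<And>n. \<not> bracketable M \<eta> (Y n)" "\<And>n. Y (Suc n) \<subseteq> Y n"
    "\<And>n Y'. Y' \<subseteq> Y n \<Longrightarrow> \<not> bracketable M \<eta> Y' \<Longrightarrow>
       integral\<^sup>L M (envelope_gap (Y (Suc n))) \<le> integral\<^sup>L M (envelope_gap Y') + 1 / real (Suc n)"
proof -
  let ?I = "\<lambda>Y. integral\<^sup>L M (envelope_gap Y)"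
  have ne: "Y \<noteq> {}" if "\<not> bracketable M \<eta> Y" for Y
    using that bracketable_empty by blast
  have I0: "0 \<le> ?I Y" if Y: "Y \<subseteq> Z" "Y \<noteq> {}" for Y
  proof (rule Bochner_Integration.integral_nonneg)
    show "0 \<le> envelope_gap Y x" for x
      using envelope_bounds[OF Y(1), of _ x] Y(2) unfolding envelope_gap_def by fastforce
  qed
  have "\<exists>Y. \<forall>n. (Y n \<subseteq> Z \<and> \<not> bracketable M \<eta> (Y n)) \<and> (Y (Suc n) \<subseteq> Y n \<and>
      (\<forall>Y'. Y' \<subseteq> Y n \<longrightarrow> \<not> bracketable M \<eta> Y' \<longrightarrow> ?I (Y (Suc n)) \<le> ?I Y' + 1 / real (Suc n)))"
  proof (rule dependent_nat_choice)
    show "\<exists>Y. Y \<subseteq> Z \<and> \<not> bracketable M \<eta> Y"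
      using \<eta> by blast
    fix Y and n :: nat assume Y: "Y \<subseteq> Z \<and> \<not> bracketable M \<eta> Y"
    define S where "S = {?I Y' |Y'. Y' \<subseteq> Y \<and> \<not> bracketable M \<eta> Y'}"
    have S: "S \<noteq> {}" "bdd_below S"
    proof -
      show "S \<noteq> {}"
        unfolding S_def using Y by blast
      show "bdd_below S"
        unfolding S_def using I0 ne Y by (intro bdd_belowI[of _ 0]) blast
    qed
    have "\<exists>s\<in>S. s < Inf S + 1 / real (Suc n)"
      using cInf_lessD[OF S(1), of "Inf S + 1 / real (Suc n)"] by simp
    then obtain Y1 where Y1: "Y1 \<subseteq> Y" "\<not> bracketable M \<eta> Y1" "?I Y1 < Inf S + 1 / real (Suc n)"
      unfolding S_def by blast
    have "?I Y1 \<le> ?I Y' + 1 / real (Suc n)" if "Y' \<subseteq> Y" "\<not> bracketable M \<eta> Y'" for Y'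
    proof -
      have "Inf S \<le> ?I Y'"
        using that S(2) unfolding S_def by (intro cInf_lower) auto
      then show ?thesis using Y1(3) by linarith
    qed
    then show "\<exists>Y1. (Y1 \<subseteq> Z \<and> \<not> bracketable M \<eta> Y1) \<and> (Y1 \<subseteq> Y \<and>
      (\<forall>Y'. Y' \<subseteq> Y \<longrightarrow> \<not> bracketable M \<eta> Y' \<longrightarrow> ?I Y1 \<le> ?I Y' + 1 / real (Suc n)))"
      using Y1 Y by (intro exI[of _ Y1]) auto
  qed
  then obtain Y where Y: "\<And>n. (Y n \<subseteq> Z \<and> \<not> bracketable M \<eta> (Y n)) \<and> (Y (Suc n) \<subseteq> Y n \<and>
      (\<forall>Y'. Y' \<subseteq> Y n \<longrightarrow> \<not> bracketable M \<eta> Y' \<longrightarrow> ?I (Y (Suc n)) \<le> ?I Y' + 1 / real (Suc n)))"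
    by blast
  show thesis
    by (rule that[of Y]) (use Y in auto)
qed

text \<open>
  Along a decreasing sequence the envelopes converge monotonically. If the limits agreed almost
  everywhere, dominated convergence would make the mean gaps tend to \<open>0\<close>; otherwise the limits
  are separated by rational numbers on a set of positive measure.
\<close>

lemma gap_persists_on_positive_set:
  assumes Y: "\<And>n. Y n \<subseteq> Z" "\<And>n. Y n \<noteq> {}" "\<And>n. Y (Suc n) \<subseteq> Y n"
    and large: "\<And>n. \<eta> < integral\<^sup>L M (envelope_gap (Y n))" and "\<eta> > 0"
  obtains a b where "a < b" "0 < prob {x\<in>space M. \<forall>n. lower (Y n) x \<le> a \<and> b \<le> upper (Y n) x}"
proof -
  define D where "D a b = {x\<in>space M. \<forall>n. lower (Y n) x \<le> a \<and> b \<le> upper (Y n) x}" for a b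
  have D: "D a b \<in> sets M" for a b
    unfolding D_def using envelope_measurable[OF Y(1)] by measurable
  have "\<exists>a b. a < b \<and> 0 < prob (D a b)"
  proof (rule ccontr)
    assume no: "\<not> ?thesis"
    have "AE x in M. \<forall>a b :: rat. a < b \<longrightarrow> x \<notin> D (real_of_rat a) (real_of_rat b)"
      unfolding AE_all_countable
    proof (intro allI)
      fix a b :: rat
      show "AE x in M. a < b \<longrightarrow> x \<notin> D (real_of_rat a) (real_of_rat b)"
      proof (cases "a < b")
        case True
        then have "real_of_rat a < real_of_rat b"
          by (simp add: of_rat_less)
        then have "D (real_of_rat a) (real_of_rat b) \<in> null_sets M"
          using no D by (auto simp: null_sets_def emeasure_eq_measure zero_less_measure_iff)
        from AE_not_in[OF this] show ?thesis
          by eventually_elim simp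
      qed simp
    qed
    then have lim: "AE x in M. (\<lambda>n. envelope_gap (Y n) x) \<longlonglongrightarrow> 0"
      using AE_space
    proof eventually_elim
      case (elim x)
      have dec: "decseq (\<lambda>n. upper (Y n) x)"
        by (intro decseq_SucI cSUP_subset_mono bdd_family Y) auto
      have inc: "incseq (\<lambda>n. lower (Y n) x)"
        by (intro incseq_SucI cINF_superset_mono bdd_family Y) auto
      have bb: "bdd_below (range (\<lambda>n. upper (Y n) x))" "bdd_above (range (\<lambda>n. lower (Y n) x))"
        using envelope_abs_le[OF Y(1) Y(2), where x = x]
        by (auto intro!: bdd_belowI2[of _ "- B"] bdd_aboveI2[of _ _ B] simp: abs_le_iff minus_le_iff)
      let ?U = "INF n. upper (Y n) x" and ?L = "SUP n. lower (Y n) x"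
      have lim: "(\<lambda>n. envelope_gap (Y n) x) \<longlonglongrightarrow> ?U - ?L"
        unfolding envelope_gap_def
        by (intro tendsto_diff LIMSEQ_decseq_INF LIMSEQ_incseq_SUP bb dec inc)
      have nn: "0 \<le> envelope_gap (Y n) x" for n
      proof -
        obtain f where "f \<in> Y n" using Y(2) by blast
        from envelope_bounds(1,2)[OF Y(1) this, of x] show ?thesis
          unfolding envelope_gap_def by linarith
      qed
      have "\<not> ?L < ?U"
      proof
        assume "?L < ?U"
        then obtain p where p: "?L < real_of_rat p" "real_of_rat p < ?U"
          using of_rat_dense by blast
        obtain q where q: "real_of_rat p < real_of_rat q" "real_of_rat q < ?U"
          using of_rat_dense[OF p(2)] by blast
        have "lower (Y n) x \<le> real_of_rat p" for n
          using cSUP_upper[OF UNIV_I bb(2), of n] p(1) by linarith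
        moreover have "real_of_rat q \<le> upper (Y n) x" for n
          using cINF_lower[OF bb(1) UNIV_I, of n] q(2) by linarith
        ultimately have "x \<in> D (real_of_rat p) (real_of_rat q)"
          unfolding D_def using elim(2) by simp
        moreover have "p < q"
          using q(1) by (simp add: of_rat_less)
        ultimately show False
          using elim(1) by blast
      qed
      moreover have "0 \<le> ?U - ?L"
        using lim nn by (intro LIMSEQ_le_const) auto
      ultimately have "?U - ?L = 0"
        by linarith
      then show ?case
        using lim by simp
    qed
    have "(\<lambda>n. integral\<^sup>L M (envelope_gap (Y n))) \<longlonglongrightarrow> integral\<^sup>L M (\<lambda>_. 0)"
    proof (rule integral_dominated_convergence[where w = "\<lambda>_. 2 * B"])
      show "AE x in M. norm (envelope_gap (Y n) x) \<le> 2 * B" for n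
      proof (rule AE_I2)
        fix x
        show "norm (envelope_gap (Y n) x) \<le> 2 * B"
          using envelope_abs_le[OF Y(1) Y(2), where x = x, of n] unfolding envelope_gap_def by simp
      qed
    qed (use lim envelope_integrable(3)[OF Y(1,2)] in auto)
    then have "\<eta> \<le> 0"
      using large by (intro LIMSEQ_le_const[of "\<lambda>n. integral\<^sup>L M (envelope_gap (Y n))"]) (auto intro: less_imp_le)
    then show False
      using \<open>\<eta> > 0\<close> by simp
  qed
  then show thesis
    using that unfolding D_def by blast
qed

end

text \<open>
  On \<open>D\<close> the envelopes of all members of the chain reach down to \<open>a\<close> and up to \<open>b\<close>. The levels of
  the splitting set lie strictly inside \<open>[a, b]\<close>: a class that stays on one side of such a level
  on a portion of \<open>D\<close> of measure at least \<open>\<delta>\<close> has its gap reduced there by \<open>\<kappa>\<close>, so that its mean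
  gap drops by \<open>\<kappa> \<sqdot> \<delta>\<close>, more than near-minimality allows late in the chain.
\<close>

lemma not_bracketable_imp_splitting_set:
  fixes M :: "'a::metric_space measure"
  assumes cpt: "compact (UNIV :: 'a set)" and sets: "sets M = sets borel"
    and fam: "bounded_countable_family M Z B"
    and "\<eta> > 0" and nb: "\<not> bracketable M \<eta> Z"
  obtains \<alpha> \<beta> C where "\<alpha> < \<beta>" "splitting_set Z \<alpha> \<beta> C"
proof -
  interpret bounded_countable_family M Z B by fact
  let ?I = "\<lambda>Y. integral\<^sup>L M (envelope_gap Y)"
  obtain Y where Y: "\<And>n. Y n \<subseteq> Z" "\<And>n. \<not> bracketable M \<eta> (Y n)" "\<And>n. Y (Suc n) \<subseteq> Y n"
    and min: "\<And>n Y'. Y' \<subseteq> Y n \<Longrightarrow> \<not> bracketable M \<eta> Y' \<Longrightarrow> ?I (Y (Suc n)) \<le> ?I Y' + 1 / real (Suc n)"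
    using exists_nearly_minimal_chain[OF nb] by metis
  have ne: "Y' \<noteq> {}" if "\<not> bracketable M \<eta> Y'" for Y'
    using that bracketable_empty by blast
  have large: "\<eta> < ?I (Y n)" for n
  proof (rule ccontr)
    assume "\<not> ?thesis"
    then have "bracketable M \<eta> (Y n)"
      unfolding bracketable_def using ne[OF Y(2)] by (intro exI[of _ "{Y n}"]) auto
    then show False
      using Y(2) by blast
  qed
  obtain a b where ab: "a < b" and pos: "0 < prob {x\<in>space M. \<forall>n. lower (Y n) x \<le> a \<and> b \<le> upper (Y n) x}"
    using gap_persists_on_positive_set[of Y \<eta>, OF Y(1) ne[OF Y(2)] Y(3) large \<open>\<eta> > 0\<close>] by blast
  define D where "D = {x\<in>space M. \<forall>n. lower (Y n) x \<le> a \<and> b \<le> upper (Y n) x}"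
  have D: "D \<in> sets M"
    unfolding D_def using envelope_measurable[OF Y(1)] by measurable
  obtain C where C: "closed C" "C \<noteq> {}" "\<And>U. open U \<Longrightarrow> U \<inter> C \<noteq> {} \<Longrightarrow> 0 < prob (U \<inter> D \<inter> C)"
    using essential_closed_subset[OF cpt finite_measure_axioms sets D] pos unfolding D_def by blast
  define \<kappa> where "\<kappa> = (b - a) / 3"
  have \<kappa>: "\<kappa> > 0"
    unfolding \<kappa>_def using ab by simp
  have "splitting_set Z (a + \<kappa>) (b - \<kappa>) C"
    unfolding splitting_set_def
  proof (intro conjI allI impI)
    fix \<U> :: "'a set set" assume \<U>: "finite \<U>" "\<forall>U\<in>\<U>. open U \<and> U \<inter> C \<noteq> {}"
    show "\<exists>f\<in>Z. \<forall>U\<in>\<U>. \<forall>c. U \<inter> C \<inter> side (a + \<kappa>) (b - \<kappa>) f c \<noteq> {}"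
    proof (rule ccontr)
      assume no: "\<not> ?thesis"
      \<comment> \<open>The element 1 only serves to give the minimum a meaning when no open set is given.\<close>
      define R where "R = insert 1 ((\<lambda>U. prob (U \<inter> D \<inter> C)) ` \<U>)"
      define \<delta> where "\<delta> = Min R"
      have R: "finite R" "R \<noteq> {}"
        unfolding R_def using \<U>(1) by auto
      have "r > 0" if "r \<in> R" for r
        using that C(3) \<U>(2) unfolding R_def by auto
      then have \<delta>: "\<delta> > 0"
        unfolding \<delta>_def using Min_in[OF R] by blast
      have \<delta>_le: "\<delta> \<le> prob (U \<inter> D \<inter> C)" if "U \<in> \<U>" for U
        unfolding \<delta>_def using that R(1) by (intro Min_le) (auto simp: R_def)
      obtain n where n: "1 / real (Suc n) < \<kappa> * \<delta>"
        using nat_approx_posE[of "\<kappa> * \<delta>"] \<kappa> \<delta> by auto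
      \<comment> \<open>Every function fails to reach some side in some open set; sort them by such a pair.\<close>
      define part where "part p = {f\<in>Y (Suc n). fst p \<inter> C \<inter> side (a + \<kappa>) (b - \<kappa>) f (snd p) = {}}" for p
      have "Y (Suc n) = \<Union>(part ` (\<U> \<times> UNIV))"
        using no Y(1)[of "Suc n"] unfolding part_def by fastforce
      then have "\<exists>Q\<in>part ` (\<U> \<times> UNIV). \<not> bracketable M \<eta> Q"
        using bracketable_Union[of "part ` (\<U> \<times> UNIV)" "Y (Suc n)" M \<eta>] \<U>(1) Y(2)[of "Suc n"] by auto
      then obtain U c where Uc: "U \<in> \<U>" "\<not> bracketable M \<eta> (part (U, c))"
        by auto
      define Y' where "Y' = part (U, c)"
      have Y': "Y' \<subseteq> Y (Suc n)" "Y' \<noteq> {}" "Y' \<subseteq> Z" "Y' \<subseteq> Y n"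
        using ne[OF Uc(2)] Y(1)[of "Suc n"] Y(3)[of n] unfolding Y'_def part_def by auto
      let ?E = "U \<inter> D \<inter> C"
      have E: "?E \<in> sets M"
        using D C(1) \<U>(2) Uc(1) sets by (auto intro!: sets.Int)
      have mono: "lower (Y (Suc n)) x \<le> lower Y' x" "upper Y' x \<le> upper (Y (Suc n)) x" for x
        using Y' by (auto intro!: cINF_superset_mono cSUP_subset_mono bdd_family[OF Y(1)])
      have gap: "envelope_gap Y' x + \<kappa> * indicator ?E x \<le> envelope_gap (Y (Suc n)) x" for x
      proof (cases "x \<in> ?E")
        case True
        then have xD: "lower (Y (Suc n)) x \<le> a" "b \<le> upper (Y (Suc n)) x"
          unfolding D_def by auto
        have miss: "x \<notin> side (a + \<kappa>) (b - \<kappa>) f c" if "f \<in> Y'" for f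
          using that True unfolding Y'_def part_def by auto
        show ?thesis
        proof (cases c)
          case False
          then have "a + \<kappa> \<le> lower Y' x"
            using miss Y'(2) by (intro cINF_greatest) (auto simp: side_def not_less)
          then show ?thesis
            using True xD mono[of x] unfolding envelope_gap_def by simp
        next
          case c: True
          then have "upper Y' x \<le> b - \<kappa>"
            using miss Y'(2) by (intro cSUP_least) (auto simp: side_def not_less)
          then show ?thesis
            using True xD mono[of x] unfolding envelope_gap_def by simp
        qed
      next
        case False
        then show ?thesis
          using mono[of x] unfolding envelope_gap_def by simp
      qed
      have int: "integrable M (envelope_gap Y')" "integrable M (envelope_gap (Y (Suc n)))"
        using envelope_integrable(3)[OF Y'(3,2)] envelope_integrable(3)[OF Y(1) ne[OF Y(2)]] by auto
      have ind: "integrable M (\<lambda>x. \<kappa> * indicator ?E x :: real)"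
        using E by (intro integrable_mult_right integrable_real_indicator) (auto simp: less_top[symmetric])
      have "?I Y' + \<kappa> * prob ?E = (\<integral>x. envelope_gap Y' x + \<kappa> * indicator ?E x \<partial>M)"
        using int(1) ind E by (simp add: Bochner_Integration.integral_add)
      also have "\<dots> \<le> ?I (Y (Suc n))"
        using int ind gap by (intro integral_mono) auto
      also have "\<dots> \<le> ?I Y' + 1 / real (Suc n)"
        using min[OF Y'(4)] Uc(2) unfolding Y'_def by blast
      finally have "\<kappa> * prob ?E \<le> 1 / real (Suc n)"
        by simp
      moreover have "\<kappa> * \<delta> \<le> \<kappa> * prob ?E"
        using \<delta>_le[OF Uc(1)] \<kappa> by simp
      ultimately show False
        using n by linarith
    qed
  qed (use C in auto)
  moreover have "a + \<kappa> < b - \<kappa>"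
    unfolding \<kappa>_def using ab by (simp add: field_simps)
  ultimately show thesis
    using that by blast
qed

section \<open>Translates under the action\<close>

lemma continuous_act:
  assumes "continuous_right_action T act" "t \<in> carrier T"
  shows "continuous_on UNIV (\<lambda>x. act x t)"
proof -
  have "continuous_map euclidean (prod_topology euclidean (discrete_topology (carrier T))) (\<lambda>x. (x, t))"
    using assms(2) by (intro continuous_map_pairedI) auto
  moreover have "continuous_map (prod_topology euclidean (discrete_topology (carrier T))) euclidean (\<lambda>(x, t). act x t)"
    using assms(1) unfolding continuous_right_action_def by blast
  ultimately have "continuous_map euclidean euclidean ((\<lambda>(x, t). act x t) \<circ> (\<lambda>x. (x, t)))"
    by (rule continuous_map_compose)
  then show ?thesis
    by (simp add: o_def)
qed

lemma bounded_translates: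
  fixes act :: "'a::metric_space \<Rightarrow> 't \<Rightarrow> 'a" and f :: "'a \<Rightarrow> real"
  assumes "compact (UNIV :: 'a set)" "continuous_on UNIV f"
  obtains B where "\<And>h x. h \<in> translates T act f \<Longrightarrow> \<bar>h x\<bar> \<le> B"
proof -
  have "bounded (range f)"
    using compact_continuous_image[OF assms(2,1)] by (rule compact_imp_bounded)
  then obtain B where "\<And>x. \<bar>f x\<bar> \<le> B"
    unfolding bounded_iff by auto
  then show thesis
    by (intro that[of B]) (auto simp: translates_def)
qed

lemma continuous_translates:
  assumes "continuous_right_action T act" "continuous_on UNIV (f :: 'a::topological_space \<Rightarrow> real)"
    "h \<in> translates T act f"
  shows "continuous_on UNIV h"
proof -
  obtain t where t: "t \<in> carrier T" "h = (\<lambda>x. f (act x t))"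
    using assms(3) unfolding translates_def by blast
  show ?thesis
    unfolding t(2) using continuous_on_compose2[OF assms(2) continuous_act[OF assms(1) t(1)]] by simp
qed

text \<open>
  The set \<open>C\<close> on which \<open>f \<circ> p\<close> oscillates is a splitting set: a neighbourhood of \<open>p\<close> in the topology
  of pointwise convergence prescribes, at one point of either side in each of the given open sets,
  the side on which \<open>f\<close> is to lie, and it contains a translation.
\<close>

lemma not_tame_imp_splitting_set:
  fixes act :: "'a::metric_space \<Rightarrow> 't \<Rightarrow> 'a"
  assumes cpt: "compact (UNIV :: 'a set)" and nt: "\<not> tame T act"
  obtains f \<alpha> \<beta> C where "continuous_on UNIV f" "\<alpha> < \<beta>" "splitting_set (translates T act f) \<alpha> \<beta> C"
proof -
  obtain p where p: "p \<in> enveloping_semigroup T act" "\<not> baire_class_1 p"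
    using nt unfolding tame_def by blast
  obtain f :: "'a \<Rightarrow> real" where f: "continuous_on UNIV f"
    and nl: "\<not> (\<exists>g::nat \<Rightarrow> 'a \<Rightarrow> real. (\<forall>n. continuous_on UNIV (g n)) \<and> (\<forall>x. (\<lambda>n. g n x) \<longlonglongrightarrow> f (p x)))"
    using p(2) unfolding baire_class_1_def by auto
  have "bounded (range f)"
    using compact_continuous_image[OF f cpt] by (rule compact_imp_bounded)
  then obtain B where B: "\<And>x. \<bar>f x\<bar> \<le> B"
    unfolding bounded_iff by auto
  obtain a b C where ab: "a < b" and C: "closed C" "C \<noteq> {}"
    and osc: "\<And>U. open U \<Longrightarrow> U \<inter> C \<noteq> {} \<Longrightarrow> (\<exists>x\<in>U \<inter> C. f (p x) < a) \<and> (\<exists>x\<in>U \<inter> C. b < f (p x))"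
    using non_limit_of_continuous_oscillates[OF cpt B nl] by metis
  have "splitting_set (translates T act f) a b C"
    unfolding splitting_set_def
  proof (intro conjI allI impI)
    fix \<U> :: "'a set set" assume \<U>: "finite \<U>" "\<forall>U\<in>\<U>. open U \<and> U \<inter> C \<noteq> {}"
    have "\<exists>x. U \<in> \<U> \<longrightarrow> x \<in> U \<inter> C \<and> p x \<in> side a b f c" for U c
      using osc[of U] \<U>(2) by (cases c) (auto simp: side_def)
    then obtain x where x: "\<And>U c. U \<in> \<U> \<Longrightarrow> x U c \<in> U \<inter> C \<and> p (x U c) \<in> side a b f c"
      by metis
    define W where "W = (\<Inter>(U, c)\<in>\<U> \<times> UNIV. {q. q (x U c) \<in> side a b f c})"
    have "open {q :: 'a \<Rightarrow> 'a. q y \<in> V}" if "open V" for y V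
      using open_vimage[OF that continuous_on_product_coordinates[of y]] by (simp add: vimage_def)
    then have "open W"
      unfolding W_def using \<U>(1) open_side[OF f] by (intro open_INT) auto
    moreover have "p \<in> W"
      unfolding W_def using x by auto
    ultimately have "(\<lambda>t x. act x t) ` carrier T \<inter> W \<noteq> {}"
      using p(1) unfolding enveloping_semigroup_def closure_iff_nhds_not_empty by blast
    then obtain t where t: "t \<in> carrier T" "(\<lambda>x. act x t) \<in> W"
      by blast
    show "\<exists>h\<in>translates T act f. \<forall>U\<in>\<U>. \<forall>c. U \<inter> C \<inter> side a b h c \<noteq> {}"
    proof (intro bexI ballI allI)
      show "(\<lambda>x. f (act x t)) \<in> translates T act f"
        unfolding translates_def using t(1) by blast
      fix U c assume U: "U \<in> \<U>"
      then have "act (x U c) t \<in> side a b f c"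
        using t(2) unfolding W_def by auto
      then have "x U c \<in> U \<inter> C \<inter> side a b (\<lambda>x. f (act x t)) c"
        using x[OF U, of c] by (simp add: side_def)
      then show "U \<inter> C \<inter> side a b (\<lambda>x. f (act x t)) c \<noteq> {}"
        by blast
    qed
  qed (use C in auto)
  then show thesis
    using that f ab by blast
qed

theorem theorem4p12:
  fixes T :: "('t, 'b) monoid_scheme"
    and act :: "'a::metric_space \<Rightarrow> 't \<Rightarrow> 'a"
  assumes "compact (UNIV :: 'a set)"
    and "countable (carrier T)"
    and "continuous_right_action T act"
  shows "(tame T act \<longleftrightarrow>
           (\<forall>(f :: 'a \<Rightarrow> real) (\<mu> :: 'a measure).
              continuous_on UNIV f \<longrightarrow> prob_space \<mu> \<longrightarrow> sets \<mu> = sets borel \<longrightarrow>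
              glivenko_cantelli \<mu> (translates T act f)))
       \<and> (tame T act \<longleftrightarrow>
           (\<forall>(f :: 'a \<Rightarrow> real) (\<mu> :: 'a measure).
              continuous_on UNIV f \<longrightarrow> prob_space \<mu> \<longrightarrow> sets \<mu> = sets borel \<longrightarrow>
              no_irregularity_witness \<mu> (translates T act f)))"
proof -
  have cont: "continuous_on UNIV h" if "continuous_on UNIV f" "h \<in> translates T act f" for f :: "'a \<Rightarrow> real" and h
    using continuous_translates[OF assms(3)] that .
  have no_split: "\<not> splitting_set (translates T act f) \<alpha> \<beta> C"
    if "tame T act" "continuous_on UNIV f" "\<alpha> < \<beta>" for f \<alpha> \<beta> C
    using splitting_set_imp_cantor_independent[OF assms(1) cont[OF that(2)]]
      cantor_independent_imp_not_tame[OF assms(1) that(2,3)] that(1) by blast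
  have gc: "glivenko_cantelli \<mu> (translates T act f)"
    if g: "tame T act" "continuous_on UNIV f" "prob_space \<mu>" "sets \<mu> = sets borel" for f and \<mu> :: "'a measure"
  proof -
    obtain B where B: "\<And>h x. h \<in> translates T act f \<Longrightarrow> \<bar>h x\<bar> \<le> B"
      using bounded_translates[OF assms(1) g(2)] by blast
    interpret prob_space \<mu> by fact
    have fam: "bounded_countable_family \<mu> (translates T act f) B"
    proof unfold_locales
      show "countable (translates T act f)"
        unfolding translates_def using assms(2) by simp
      show "h \<in> borel_measurable \<mu>" if "h \<in> translates T act f" for h
        using borel_measurable_continuous_onI[OF cont[OF \<open>continuous_on UNIV f\<close> that]] \<open>sets \<mu> = sets borel\<close>
        by (simp cong: measurable_cong_sets)
    qed (use B in auto)
    show ?thesis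
      using bounded_countable_family.bracketable_imp_glivenko_cantelli[OF fam]
        not_bracketable_imp_splitting_set[OF assms(1) g(4) fam] no_split[OF g(1,2)] by metis
  qed
  have nw: "no_irregularity_witness \<mu> (translates T act f)"
    if "tame T act" "continuous_on UNIV f" "prob_space \<mu>" "sets \<mu> = sets borel" for f and \<mu> :: "'a measure"
    unfolding no_irregularity_witness_def
    using witness_imp_splitting_set[OF assms(1) that(3,4)] no_split[OF that(1,2)] by metis
  have conv: "\<exists>f (\<mu> :: 'a measure). continuous_on UNIV f \<and> prob_space \<mu> \<and> sets \<mu> = sets borel \<and>
      \<not> glivenko_cantelli \<mu> (translates T act f) \<and> \<not> no_irregularity_witness \<mu> (translates T act f)"
    if nt: "\<not> tame T act"
  proof -
    obtain f \<alpha> \<beta> C where f: "continuous_on UNIV f" and ab: "\<alpha> < \<beta>"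
      and "splitting_set (translates T act f) \<alpha> \<beta> C"
      using not_tame_imp_splitting_set[OF assms(1) nt] by blast
    then have "cantor_independent (translates T act f) \<alpha> \<beta>"
      using splitting_set_imp_cantor_independent[OF assms(1) cont[OF f]] by blast
    then obtain M :: "'a measure" and F :: "nat \<Rightarrow> 'a \<Rightarrow> real" where fair: "fair_signs M F \<alpha> \<beta>"
      and M: "sets M = sets borel" and F: "\<And>n. F n \<in> translates T act f"
      using cantor_independent_imp_fair_signs[OF cont[OF f] ab] by metis
    interpret fair_signs M F \<alpha> \<beta> by fact
    obtain B where B: "\<And>h x. h \<in> translates T act f \<Longrightarrow> \<bar>h x\<bar> \<le> B"
      using bounded_translates[OF assms(1) f] by blast
    have "\<not> glivenko_cantelli M (translates T act f)"
      using F B by (rule not_glivenko_cantelli)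
    moreover have "irregularity_witness M (translates T act f) \<alpha> \<beta> UNIV"
      using F by (rule whole_space_irregularity_witness)
    moreover have "emeasure (completion M) UNIV \<noteq> 0"
    proof -
      have "emeasure (completion M) UNIV = emeasure M UNIV"
        using sets.top[of M] space_UNIV by (simp add: main_part)
      also have "\<dots> = 1"
        using emeasure_space_1 space_UNIV by simp
      finally show ?thesis by simp
    qed
    ultimately show ?thesis
      using f M ab prob_space_axioms unfolding no_irregularity_witness_def by blast
  qed
  show ?thesis
    using gc nw conv by blast
qed

end
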